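(* Let $0<s\le1$ and consider the fully discrete scheme in $S_N$, for $0\le n\le M-1$, $$Y^{n,0}=U^n,\quad Y^{n,j}=Y^{n,j-1}+kb_jF\Big(\tfrac{Y^{n,j}+Y^{n,j-1}}2\Big)\ (1\le j\le q),\quad U^{n+1}=Y^{n,q}.$$ Let $R=\|U^0\|$. If $$3R^2kN\max_{1\le j\le q}|b_j|<1,$$ then the solutions $Y^{n,j}$, $0\le j\le q$, of the scheme are unique. Furthermore, suppose that $s>1/2$ and that $u_0$ is such that, with $I_1=I_1(u^N(0))$, $E=H(u^N(0))$ and $C_\infty=\big(\sum_{k=-\infty}^{\infty}\frac1{1+|k|^{2s}}\big)^{1/2}$, $$1-C_\infty^2I_1>0,\qquad\frac{I_1}2+E\ge0.$$ Then, for $k$ small enough, if $U^0=u^N(0)$, there is a constant $C_U$, independent of $N$, such that $$\max_{0\le n\le M}\|U^n\|_s\le C_U .$$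
   Context: $T>0$ fixed; $u_0$ is smooth and $2\pi$-periodic. Functions are complex-valued and $2\pi$-periodic; $\|\cdot\|$ is the norm of $L^2(-\pi,\pi)$. $\widehat u(k)=\frac1{2\pi}\int_{-\pi}^{\pi}u(x)e^{-ikx}dx$; $\|u\|_s=(\sum_{k\in\mathbb Z}(1+k^2)^s|\widehat u(k)|^2)^{1/2}$; $(-\partial_{xx})^s$ has Fourier symbol $|k|^{2s}$, $|D|^s=(-\partial_{xx})^{s/2}$. $N\ge1$ is an integer, $S_N=\mathrm{span}\{e^{ikx}:-N\le k\le N\}$, $P_Nu=\sum_{|k|\le N}\widehat u(k)e^{ikx}$, and $F:S_N\to S_N$, $F(u)=-i(-\partial_{xx})^su+iP_N(|u|^2u)$. The semidiscrete solution $u^N$ with values in $S_N$ solves $\frac{d}{dt}u^N=F(u^N)$, $u^N(0)=P_Nu_0$. $I_1(u)=\frac12\int_{-\pi}^{\pi}|u|^2dx$, $H(u)=\frac12\int_{-\pi}^{\pi}\big(||D|^su|^2-\frac12|u|^4\big)dx$. $k>0$ is the time step and $M$ an integer with $T=Mk$. For $p\ge1$ the method has $q=3^{p-1}$ stages with nonzero real coefficients $b_1,\dots,b_q$ of Yoshida's triple-jump composition: for $p=1$, $b_1=1$; if $b=(b_1,\dots,b_q)$ is the vector for $p$, the one for $p+1$ is the concatenation $(\gamma b,(1-2\gamma)b,\gamma b)$ with $\gamma=1/(2-2^{1/(2p+1)})$. *)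

theory Defs
  imports "HOL-Analysis.Analysis"
begin

text \<open>Periodic functions are functions \<open>real \<Rightarrow> complex\<close> on the whole line; norms and Fourier
  coefficients only look at one period.\<close>

definition periodic2pi :: "(real \<Rightarrow> complex) \<Rightarrow> bool" where
  "periodic2pi u \<longleftrightarrow> (\<forall>x. u (x + 2 * pi) = u x)"

definition smooth :: "(real \<Rightarrow> complex) \<Rightarrow> bool" where
  "smooth u \<longleftrightarrow>
     (\<forall>n x. ((\<lambda>f y. vector_derivative f (at y)) ^^ n) u differentiable (at x))"

definition L2norm :: "(real \<Rightarrow> complex) \<Rightarrow> real" where
  "L2norm u = sqrt (integral {-pi..pi} (\<lambda>x. (cmod (u x))\<^sup>2))"

definition fourier_coeff :: "(real \<Rightarrow> complex) \<Rightarrow> int \<Rightarrow> complex" where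
  "fourier_coeff u k =
     1 / complex_of_real (2 * pi) *
       integral {-pi..pi} (\<lambda>x. u x * exp (- \<i> * of_int k * complex_of_real x))"

text \<open>There is no factor \<open>2 * pi\<close> here, so \<open>L2norm u = sqrt (2 * pi) * sobolev_norm 0 u\<close>
  for square-integrable \<open>u\<close>.\<close>

definition sobolev_norm :: "real \<Rightarrow> (real \<Rightarrow> complex) \<Rightarrow> real" where
  "sobolev_norm s u =
     sqrt (\<Sum>\<^sub>\<infinity>k\<in>(UNIV::int set). (1 + (real_of_int k)\<^sup>2) powr s * (cmod (fourier_coeff u k))\<^sup>2)"

definition fourier_mult :: "(int \<Rightarrow> real) \<Rightarrow> (real \<Rightarrow> complex) \<Rightarrow> real \<Rightarrow> complex" where
  "fourier_mult m u x =
     (\<Sum>\<^sub>\<infinity>k\<in>(UNIV::int set).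
        complex_of_real (m k) * fourier_coeff u k * exp (\<i> * of_int k * complex_of_real x))"

text \<open>Since \<open>0 powr a = 0\<close>, the symbol vanishes at the zero frequency, as it should for \<open>s > 0\<close>.\<close>

definition frac_lap :: "real \<Rightarrow> (real \<Rightarrow> complex) \<Rightarrow> real \<Rightarrow> complex" where
  "frac_lap s = fourier_mult (\<lambda>k. \<bar>real_of_int k\<bar> powr (2 * s))"

definition abs_D :: "real \<Rightarrow> (real \<Rightarrow> complex) \<Rightarrow> real \<Rightarrow> complex" where
  "abs_D s = frac_lap (s / 2)"

text \<open>The complex span of the exponentials with frequencies in \<open>{-N..N}\<close>.\<close>

definition trig_space :: "nat \<Rightarrow> (real \<Rightarrow> complex) set" where
  "trig_space N =
     {u. \<exists>c :: int \<Rightarrow> complex.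
           u = (\<lambda>x. \<Sum>k\<in>{- int N..int N}. c k * exp (\<i> * of_int k * complex_of_real x))}"

definition proj :: "nat \<Rightarrow> (real \<Rightarrow> complex) \<Rightarrow> real \<Rightarrow> complex" where
  "proj N u x =
     (\<Sum>k\<in>{- int N..int N}. fourier_coeff u k * exp (\<i> * of_int k * complex_of_real x))"

definition F_rhs :: "real \<Rightarrow> nat \<Rightarrow> (real \<Rightarrow> complex) \<Rightarrow> real \<Rightarrow> complex" where
  "F_rhs s N u x =
     - \<i> * frac_lap s u x + \<i> * proj N (\<lambda>y. complex_of_real ((cmod (u y))\<^sup>2) * u y) x"

definition I1 :: "(real \<Rightarrow> complex) \<Rightarrow> real" where
  "I1 u = 1 / 2 * integral {-pi..pi} (\<lambda>x. (cmod (u x))\<^sup>2)"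

definition Ham :: "real \<Rightarrow> (real \<Rightarrow> complex) \<Rightarrow> real" where
  "Ham s u =
     1 / 2 * integral {-pi..pi} (\<lambda>x. (cmod (abs_D s u x))\<^sup>2 - 1 / 2 * (cmod (u x)) ^ 4)"

definition C_infty :: "real \<Rightarrow> real" where
  "C_infty s = sqrt (\<Sum>\<^sub>\<infinity>k\<in>(UNIV::int set). 1 / (1 + \<bar>real_of_int k\<bar> powr (2 * s)))"

text \<open>Coefficients of the triple-jump composition; only the values for \<open>p \<ge> 1\<close> are meaningful.\<close>

fun triple_jump :: "nat \<Rightarrow> real list" where
  "triple_jump 0 = []"
| "triple_jump (Suc 0) = [1]"
| "triple_jump (Suc (Suc m)) =
     (let p = Suc m;
          b = triple_jump p;
          \<gamma> = 1 / (2 - 2 powr (1 / (2 * real p + 1)))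
      in map ((*) \<gamma>) b @ map ((*) (1 - 2 * \<gamma>)) b @ map ((*) \<gamma>) b)"

definition stages :: "nat \<Rightarrow> nat" where
  "stages p = 3 ^ (p - 1)"

text \<open>Stage coefficients \<open>b\<^sub>1, \<dots>, b\<^sub>q\<close>, indexed from one.\<close>

definition bcoef :: "nat \<Rightarrow> nat \<Rightarrow> real" where
  "bcoef p j = triple_jump p ! (j - 1)"

lemma length_triple_jump: "p \<ge> 1 \<Longrightarrow> length (triple_jump p) = stages p"
  by (induction p rule: triple_jump.induct) (auto simp: stages_def Let_def)

text \<open>\<open>U\<close>, \<open>Y\<close> solve the fully discrete scheme with time step \<open>k\<close> and \<open>M\<close> steps. The stages are
  given by implicit equations, so this is a relation.\<close>

definition fully_discrete ::
  "real \<Rightarrow> nat \<Rightarrow> nat \<Rightarrow> real \<Rightarrow> nat \<Rightarrow>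
   (nat \<Rightarrow> real \<Rightarrow> complex) \<Rightarrow> (nat \<Rightarrow> nat \<Rightarrow> real \<Rightarrow> complex) \<Rightarrow> bool" where
  "fully_discrete s N p k M U Y \<longleftrightarrow>
     (\<forall>n\<le>M. U n \<in> trig_space N) \<and>
     (\<forall>n<M. \<forall>j\<le>stages p. Y n j \<in> trig_space N) \<and>
     (\<forall>n<M.
        Y n 0 = U n \<and>
        (\<forall>j\<in>{1..stages p}.
           Y n j = (\<lambda>x. Y n (j - 1) x +
             complex_of_real (k * bcoef p j) *
               F_rhs s N (\<lambda>y. (Y n j y + Y n (j - 1) y) / 2) x)) \<and>
        U (Suc n) = Y n (stages p))"

end

theory Submission
  imports Defs
begin

text \<open>
  Write one stage as \<open>Y\<^sub>0 = w - d\<close>, \<open>Y\<^sub>1 = w + d\<close> with midpoint \<open>w\<close> and \<open>d = h F(w)\<close>. Then \<open>d\<close> is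
  orthogonal to \<open>w\<close> (so the mass is conserved) and tangent to the level set of the Hamiltonian at
  \<open>w\<close>, which leaves only the cubic defect \<open>H(Y\<^sub>1) - H(Y\<^sub>0) = - 2 \<integral> |d|\<^sup>2 Re (w cnj d)\<close>.
  Pairing the stage equation with the gradient of the Hamiltonian bounds \<open>|D|\<^sup>s w\<close> by \<open>|D|\<^sup>s Y\<^sub>0\<close> and
  the mass alone, for every solution of the implicit equation. Hence \<open>\<parallel>d\<parallel>\<^sup>2 = O(h)\<close>, and since
  \<open>|u|\<^sup>2 \<le> \<epsilon> \<parallel>|D|\<^sup>s u\<parallel>\<^sup>2 + C\<^sub>\<epsilon> \<parallel>u\<parallel>\<^sup>2\<close> for \<open>s > 1/2\<close>, the supremum of \<open>d\<close> tends to \<open>0\<close> with \<open>h\<close>. The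
  energy defect per stage is therefore \<open>o(h)\<close> uniformly in \<open>N\<close>, the total drift over \<open>[0,T]\<close> is at
  most \<open>1\<close> for small steps, and coercivity of \<open>H\<close> at fixed mass gives the Sobolev bound.
  Uniqueness is the inverse inequality \<open>2\<pi> |u|\<^sup>2 \<le> (2N + 1) \<parallel>u\<parallel>\<^sup>2\<close> on trigonometric polynomials
  combined with the Lipschitz bound for the cubic term, the linear part being skew.
\<close>

section \<open>Trigonometric polynomials and the quadratic forms\<close>

text \<open>The real part of the complex L2 product. In this real structure multiplication by i is
  skew-symmetric, which all conservation identities below exploit.\<close>

definition rip :: "(real \<Rightarrow> complex) \<Rightarrow> (real \<Rightarrow> complex) \<Rightarrow> real" where
  "rip u v = integral {-pi..pi} (\<lambda>x. u x \<bullet> v x)"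

definition trig :: "nat \<Rightarrow> (int \<Rightarrow> complex) \<Rightarrow> real \<Rightarrow> complex" where
  "trig N c x = (\<Sum>k\<in>{- int N..int N}. c k * exp (\<i> * of_int k * complex_of_real x))"

text \<open>On trigonometric polynomials of degree at most \<open>N\<close> this is the real pairing of \<open>|D|\<^sup>s u\<close> with \<open>|D|\<^sup>s v\<close>.\<close>

definition Dform :: "real \<Rightarrow> nat \<Rightarrow> (real \<Rightarrow> complex) \<Rightarrow> (real \<Rightarrow> complex) \<Rightarrow> real" where
  "Dform s N u v = 2 * pi * (\<Sum>k\<in>{- int N..int N}.
     \<bar>real_of_int k\<bar> powr (2 * s) * (fourier_coeff u k \<bullet> fourier_coeff v k))"

definition cubic :: "(real \<Rightarrow> complex) \<Rightarrow> real \<Rightarrow> complex" where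
  "cubic u x = complex_of_real ((cmod (u x))\<^sup>2) * u x"

lemma trig_space_iff: "u \<in> trig_space N \<longleftrightarrow> (\<exists>c. u = trig N c)"
  by (simp add: trig_space_def trig_def fun_eq_iff)

lemma proj_eq_trig: "proj N u = trig N (fourier_coeff u)"
  by (simp add: proj_def trig_def fun_eq_iff)

lemma trig_in_trig_space [simp, intro]: "trig N c \<in> trig_space N"
  by (auto simp: trig_space_iff)

lemma continuous_on_trig: "continuous_on UNIV (trig N c)"
  unfolding trig_def by (intro continuous_intros)

lemma continuous_on_trig_space: "u \<in> trig_space N \<Longrightarrow> continuous_on UNIV u"
  by (auto simp: trig_space_iff continuous_on_trig)

lemma continuous_on_cubic: "continuous_on UNIV u \<Longrightarrow> continuous_on UNIV (cubic u)"
  unfolding cubic_def by (intro continuous_intros)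

lemma integrable_period:
  fixes f :: "real \<Rightarrow> 'a::banach"
  shows "continuous_on UNIV f \<Longrightarrow> f integrable_on {-pi..pi}"
  by (rule integrable_continuous_interval) (rule continuous_on_subset, auto)

lemma integral_mono_period:
  fixes f g :: "real \<Rightarrow> real"
  assumes "continuous_on UNIV f" "continuous_on UNIV g" "\<And>x. f x \<le> g x"
  shows "integral {-pi..pi} f \<le> integral {-pi..pi} g"
  using assms by (intro integral_le integrable_period) auto

lemma rip_commute: "rip u v = rip v u"
  by (simp add: rip_def inner_commute)

lemma rip_scale_left: "rip (\<lambda>x. complex_of_real a * u x) v = a * rip u v"
  by (simp add: rip_def scaleR_conv_of_real [symmetric])

lemma rip_add_left:
  assumes "continuous_on UNIV u" "continuous_on UNIV u'" "continuous_on UNIV v"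
  shows "rip (\<lambda>x. u x + u' x) v = rip u v + rip u' v"
  unfolding rip_def inner_add_left
  by (intro integral_add integrable_period continuous_intros assms)

lemma rip_diff_left:
  assumes "continuous_on UNIV u" "continuous_on UNIV u'" "continuous_on UNIV v"
  shows "rip (\<lambda>x. u x - u' x) v = rip u v - rip u' v"
  unfolding rip_def inner_diff_left
  by (intro integral_diff integrable_period continuous_intros assms)

lemma rip_add_right:
  assumes "continuous_on UNIV u" "continuous_on UNIV u'" "continuous_on UNIV v"
  shows "rip v (\<lambda>x. u x + u' x) = rip v u + rip v u'"
  using rip_add_left[OF assms] by (simp add: rip_commute[of v])

lemma rip_diff_right:
  assumes "continuous_on UNIV u" "continuous_on UNIV u'" "continuous_on UNIV v"
  shows "rip v (\<lambda>x. u x - u' x) = rip v u - rip v u'"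
  using rip_diff_left[OF assms] by (simp add: rip_commute[of v])

lemma rip_self_eq: "rip u u = integral {-pi..pi} (\<lambda>x. (cmod (u x))\<^sup>2)"
  by (simp add: rip_def power2_norm_eq_inner)

lemma rip_self_nonneg: "continuous_on UNIV u \<Longrightarrow> 0 \<le> rip u u"
  unfolding rip_def by (intro integral_nonneg integrable_period continuous_intros) auto

lemma L2norm_power2: "continuous_on UNIV u \<Longrightarrow> (L2norm u)\<^sup>2 = rip u u"
  using rip_self_nonneg[of u] by (simp add: L2norm_def rip_self_eq)

lemma rip_le:
  assumes "continuous_on UNIV u" "continuous_on UNIV v"
    and "continuous_on UNIV u'" "continuous_on UNIV v'"
    and "\<And>x. u x \<bullet> v x \<le> a * (cmod (u' x))\<^sup>2 + b * (cmod (v' x))\<^sup>2"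
  shows "rip u v \<le> a * rip u' u' + b * rip v' v'"
proof -
  have "rip u v \<le> integral {-pi..pi} (\<lambda>x. a * (cmod (u' x))\<^sup>2 + b * (cmod (v' x))\<^sup>2)"
    unfolding rip_def by (intro integral_mono_period continuous_intros assms)
  also have "\<dots> = a * rip u' u' + b * rip v' v'"
    unfolding rip_self_eq
    by (subst integral_add)
      (auto intro!: integrable_period continuous_intros assms)
  finally show ?thesis .
qed

section \<open>Fourier coefficients and Parseval for trigonometric polynomials\<close>

lemma integral_exp_int:
  "integral {-pi..pi} (\<lambda>x. exp (\<i> * of_int m * complex_of_real x)) = (if m = 0 then 2 * pi else 0)"
proof (cases "m = 0")
  case False
  define F where "F x = exp (\<i> * of_int m * complex_of_real x) / (\<i> * of_int m)" for x
  have "((\<lambda>x. exp (\<i> * of_int m * complex_of_real x)) has_integral (F pi - F (-pi))) {-pi..pi}"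
  proof (rule fundamental_theorem_of_calculus)
    show "(F has_vector_derivative exp (\<i> * of_int m * complex_of_real x)) (at x within {-pi..pi})" for x
      unfolding F_def using False
      by (auto intro!: derivative_eq_intros has_vector_derivative_real_field)
  qed simp
  moreover have "F pi = F (-pi)"
  proof -
    \<comment> \<open>The two exponents differ by 2 pi i \<open>m\<close>, hence the integer witness
      \<open>m\<close>.\<close>
    have "exp (\<i> * of_int m * of_real pi) = exp (\<i> * of_int m * complex_of_real (-pi))"
      unfolding exp_eq by (rule exI[of _ m]) (simp add: algebra_simps)
    thus ?thesis by (simp add: F_def)
  qed
  ultimately show ?thesis using False by (simp add: integral_unique)
qed (simp add: scaleR_conv_of_real)

lemma cnj_exp_int: "cnj (exp (\<i> * of_int k * complex_of_real x)) = exp (- \<i> * of_int k * complex_of_real x)"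
  by (simp add: exp_cnj)

lemma fourier_coeff_add:
  assumes "continuous_on UNIV u" "continuous_on UNIV v"
  shows "fourier_coeff (\<lambda>x. u x + v x) k = fourier_coeff u k + fourier_coeff v k"
  unfolding fourier_coeff_def distrib_right
  by (subst integral_add) (auto intro!: integrable_period continuous_intros assms simp: field_simps)

lemma fourier_coeff_mult:
  "fourier_coeff (\<lambda>x. c * u x) k = c * fourier_coeff u k"
  by (simp add: fourier_coeff_def mult.assoc)

lemma fourier_coeff_diff:
  assumes "continuous_on UNIV u" "continuous_on UNIV v"
  shows "fourier_coeff (\<lambda>x. u x - v x) k = fourier_coeff u k - fourier_coeff v k"
  using fourier_coeff_add[OF assms(1), of "\<lambda>x. (-1) * v x" k] assms(2)
  by (simp add: fourier_coeff_mult[of "-1" v, simplified] continuous_on_minus)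

lemma fourier_coeff_trig:
  "fourier_coeff (trig N c) k = (if k \<in> {- int N..int N} then c k else 0)"
proof -
  have eq: "trig N c x * exp (- \<i> * of_int k * complex_of_real x)
      = (\<Sum>j\<in>{- int N..int N}. c j * exp (\<i> * of_int (j - k) * complex_of_real x))" for x
    unfolding trig_def sum_distrib_right mult.assoc exp_add [symmetric]
    by (intro sum.cong refl arg_cong2[of _ _ _ _ "(*)"] arg_cong[of _ _ exp]) (simp_all add: algebra_simps)
  have "integral {-pi..pi} (\<lambda>x. trig N c x * exp (- \<i> * of_int k * complex_of_real x))
      = (\<Sum>j\<in>{- int N..int N}. c j * (if j - k = 0 then 2 * pi else 0))"
    unfolding eq
    by (subst integral_sum) (auto intro!: integrable_period continuous_intros sum.cong simp: integral_exp_int simp del: of_int_diff)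
  also have "\<dots> = (\<Sum>j\<in>{- int N..int N}. if j = k then c j * (2 * pi) else 0)"
    by (intro sum.cong) auto
  finally show ?thesis
    by (simp add: fourier_coeff_def sum.delta)
qed

lemma proj_trig_space: "u \<in> trig_space N \<Longrightarrow> proj N u = u"
  by (auto simp: trig_space_iff proj_eq_trig trig_def [abs_def] fourier_coeff_trig [unfolded trig_def [abs_def]])

text \<open>Only finitely many frequencies occur in the second factor, so sum and integral commute.
  This is Parseval without any convergence question for the Fourier series of
  \<open>f\<close>.\<close>

lemma rip_trig:
  assumes "continuous_on UNIV f"
  shows "rip f (trig N c) = 2 * pi * (\<Sum>k\<in>{- int N..int N}. fourier_coeff f k \<bullet> c k)"
proof -
  let ?e = "\<lambda>k x. exp (\<i> * of_int k * complex_of_real x)"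
  have one: "integral {-pi..pi} (\<lambda>x. f x \<bullet> (c k * ?e k x)) = 2 * pi * (fourier_coeff f k \<bullet> c k)" for k
  proof -
    let ?g = "\<lambda>x. f x * exp (- \<i> * of_int k * complex_of_real x)"
    have "f x \<bullet> (c k * ?e k x) = ?g x \<bullet> c k" for x
    proof -
      have "f x \<bullet> (c k * ?e k x) = Re (f x * cnj (c k * ?e k x))"
        by (simp add: inner_complex_def algebra_simps)
      also have "\<dots> = Re (?g x * cnj (c k))"
        by (simp only: complex_cnj_mult cnj_exp_int) (simp only: mult_ac)
      finally show ?thesis by (simp add: inner_complex_def)
    qed
    hence "integral {-pi..pi} (\<lambda>x. f x \<bullet> (c k * ?e k x)) = integral {-pi..pi} (\<lambda>x. ?g x \<bullet> c k)"
      by simp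
    also have "\<dots> = integral {-pi..pi} ?g \<bullet> c k"
    proof -
      have "continuous_on UNIV ?g"
        by (intro continuous_intros assms)
      from integral_linear[OF integrable_period[OF this] bounded_linear_inner_left[of "c k"]]
      show ?thesis by (simp add: o_def)
    qed
    also have "integral {-pi..pi} ?g = (2 * pi) *\<^sub>R fourier_coeff f k"
      by (simp add: fourier_coeff_def scaleR_conv_of_real)
    finally show ?thesis by simp
  qed
  show ?thesis
    unfolding rip_def trig_def inner_sum_right sum_distrib_left
    by (subst integral_sum) (auto intro!: integrable_period continuous_intros assms sum.cong simp: one)
qed

lemma rip_trig_space:
  assumes "continuous_on UNIV f" "v \<in> trig_space N"
  shows "rip f v = 2 * pi * (\<Sum>k\<in>{- int N..int N}. fourier_coeff f k \<bullet> fourier_coeff v k)"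
  using rip_trig[OF assms(1), of N "fourier_coeff v"] proj_trig_space[OF assms(2)]
  by (simp add: proj_eq_trig)

text \<open>Lets the projection in front of the cubic term be dropped whenever the test function
  lies in \<open>trig_space N\<close>.\<close>

lemma rip_proj:
  assumes "continuous_on UNIV f" "v \<in> trig_space N"
  shows "rip (proj N f) v = rip f v"
  using assms by (simp add: rip_trig_space proj_eq_trig continuous_on_trig fourier_coeff_trig)

lemma fourier_mult_trig_space:
  assumes "u \<in> trig_space N"
  shows "fourier_mult m u = trig N (\<lambda>k. complex_of_real (m k) * fourier_coeff u k)"
proof
  fix x
  have 0: "fourier_coeff u k = 0" if "k \<notin> {- int N..int N}" for k
    using assms that by (auto simp: trig_space_iff fourier_coeff_trig)
  have "fourier_mult m u x = (\<Sum>\<^sub>\<infinity>k\<in>{- int N..int N}.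
        complex_of_real (m k) * fourier_coeff u k * exp (\<i> * of_int k * complex_of_real x))"
    unfolding fourier_mult_def by (rule infsum_cong_neutral) (auto simp: 0)
  thus "fourier_mult m u x = trig N (\<lambda>k. complex_of_real (m k) * fourier_coeff u k) x"
    by (simp add: trig_def)
qed

lemma rip_frac_lap:
  assumes "u \<in> trig_space N" "v \<in> trig_space N"
  shows "rip (frac_lap s u) v = Dform s N u v"
  using assms unfolding frac_lap_def fourier_mult_trig_space[OF assms(1)] Dform_def
  by (subst rip_trig_space[OF continuous_on_trig])
    (auto simp add: fourier_coeff_trig scaleR_conv_of_real [symmetric] intro!: sum.cong)

lemma rip_abs_D:
  assumes "u \<in> trig_space N"
  shows "rip (abs_D s u) (abs_D s u) = Dform s N u u"
proof -
  \<comment> \<open>Also true at \<open>k = 0\<close>, where both sides are 0 because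
    \<open>0 powr a = 0\<close>.\<close>
  have *: "\<bar>real_of_int k\<bar> powr s * (\<bar>real_of_int k\<bar> powr s * y) = \<bar>real_of_int k\<bar> powr (2 * s) * y" for k y
    unfolding mult.assoc [symmetric] powr_add [symmetric] by simp
  show ?thesis
    using assms unfolding abs_D_def frac_lap_def fourier_mult_trig_space[OF assms(1)] Dform_def
    by (subst rip_trig_space[OF continuous_on_trig])
      (auto simp add: fourier_coeff_trig scaleR_conv_of_real [symmetric] * intro!: sum.cong)
qed

section \<open>Bilinear algebra and Young's inequality for \<open>Dform\<close>\<close>

lemma Dform_commute: "Dform s N u v = Dform s N v u"
  by (simp add: Dform_def inner_commute)

lemma Dform_nonneg: "0 \<le> Dform s N u u"
  unfolding Dform_def by (intro mult_nonneg_nonneg sum_nonneg) auto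

lemma Dform_scale: "Dform s N (\<lambda>x. complex_of_real a * u x) v = a * Dform s N u v"
  unfolding Dform_def fourier_coeff_mult
  unfolding scaleR_conv_of_real [symmetric]
  by (simp add: sum_distrib_left mult_ac)

text \<open>The symbol is real, and at each frequency i a is orthogonal to a in the real plane. This
  is the skewness of the linear part of the equation.\<close>

lemma Dform_i: "Dform s N (\<lambda>x. \<i> * u x) u = 0"
  by (simp add: Dform_def fourier_coeff_mult inner_complex_def)

lemma Dform_i_self: "Dform s N (\<lambda>x. \<i> * u x) (\<lambda>x. \<i> * u x) = Dform s N u u"
  by (simp add: Dform_def fourier_coeff_mult inner_complex_def add.commute)

lemma Dform_add_left:
  assumes "continuous_on UNIV u" "continuous_on UNIV u'"
  shows "Dform s N (\<lambda>x. u x + u' x) v = Dform s N u v + Dform s N u' v"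
  by (simp add: Dform_def fourier_coeff_add assms inner_add_left algebra_simps sum.distrib)

lemma Dform_diff_left:
  assumes "continuous_on UNIV u" "continuous_on UNIV u'"
  shows "Dform s N (\<lambda>x. u x - u' x) v = Dform s N u v - Dform s N u' v"
  by (simp add: Dform_def fourier_coeff_diff assms inner_diff_left algebra_simps sum_subtractf)

lemma Dform_add_right:
  assumes "continuous_on UNIV u" "continuous_on UNIV u'"
  shows "Dform s N v (\<lambda>x. u x + u' x) = Dform s N v u + Dform s N v u'"
  using Dform_add_left[OF assms, of s N v] by (simp add: Dform_commute[of s N v])

lemma Dform_diff_right:
  assumes "continuous_on UNIV u" "continuous_on UNIV u'"
  shows "Dform s N v (\<lambda>x. u x - u' x) = Dform s N v u - Dform s N v u'"
  using Dform_diff_left[OF assms, of s N v] by (simp add: Dform_commute[of s N v])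

lemma inner_young:
  fixes u v :: "'a::real_inner"
  assumes "a > 0"
  shows "u \<bullet> v \<le> a * (u \<bullet> u) + (1 / (4 * a)) * (v \<bullet> v)"
proof -
  \<comment> \<open>The square of a u - v/2, divided by a, has exactly the Young terms as its
    expansion.\<close>
  have "0 \<le> (1/a) * ((a *\<^sub>R u - (1/2) *\<^sub>R v) \<bullet> (a *\<^sub>R u - (1/2) *\<^sub>R v))"
    using assms by simp
  also have "\<dots> = a * (u \<bullet> u) - u \<bullet> v + (1 / (4 * a)) * (v \<bullet> v)"
    using assms by (simp add: inner_diff_left inner_diff_right inner_commute field_simps)
  finally show ?thesis by simp
qed

lemma Dform_young:
  assumes "a > 0"
  shows "Dform s N u v \<le> a * Dform s N u u + (1 / (4 * a)) * Dform s N v v"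
proof -
  have "(\<Sum>k\<in>{- int N..int N}. \<bar>real_of_int k\<bar> powr (2 * s) * (fourier_coeff u k \<bullet> fourier_coeff v k))
     \<le> (\<Sum>k\<in>{- int N..int N}. \<bar>real_of_int k\<bar> powr (2 * s) *
        (a * (fourier_coeff u k \<bullet> fourier_coeff u k) + (1 / (4 * a)) * (fourier_coeff v k \<bullet> fourier_coeff v k)))"
    by (intro sum_mono mult_left_mono inner_young assms) auto
  hence "Dform s N u v \<le> 2 * pi * (\<Sum>k\<in>{- int N..int N}. \<bar>real_of_int k\<bar> powr (2 * s) *
        (a * (fourier_coeff u k \<bullet> fourier_coeff u k) + (1 / (4 * a)) * (fourier_coeff v k \<bullet> fourier_coeff v k)))"
    unfolding Dform_def by (intro mult_left_mono) auto
  also have "\<dots> = a * Dform s N u u + (1 / (4 * a)) * Dform s N v v"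
    unfolding Dform_def distrib_left sum.distrib sum_distrib_left by (simp add: mult_ac)
  finally show ?thesis .
qed

section \<open>Sobolev inequalities uniform in the degree\<close>

text \<open>Young's inequality with weight 1/2, once for \<open>u\<close> and once for its
  negative.\<close>

lemma Dform_abs_le: "\<bar>Dform s N u v\<bar> \<le> (Dform s N u u + Dform s N v v) / 2"
  using Dform_young[of "1/2" s N u v] Dform_young[of "1/2" s N "\<lambda>x. complex_of_real (-1) * u x" v]
  unfolding Dform_scale Dform_commute[of s N u "\<lambda>x. complex_of_real (-1) * u x"]
  by (simp add: Dform_scale Dform_commute[of s N u "\<lambda>x. - u x"] Dform_scale[of s N "-1", simplified])

section \<open>Closure properties of \<open>trig_space\<close> and the weak form of
  \<open>F_rhs\<close>\<close>

lemma trig_space_add: "u \<in> trig_space N \<Longrightarrow> v \<in> trig_space N \<Longrightarrow> (\<lambda>x. u x + v x) \<in> trig_space N"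
proof -
  assume "u \<in> trig_space N" "v \<in> trig_space N"
  then obtain c d where "u = trig N c" "v = trig N d"
    by (auto simp: trig_space_iff)
  hence "(\<lambda>x. u x + v x) = trig N (\<lambda>k. c k + d k)"
    by (simp add: trig_def fun_eq_iff distrib_right sum.distrib)
  thus ?thesis by simp
qed

lemma trig_space_mult: "u \<in> trig_space N \<Longrightarrow> (\<lambda>x. a * u x) \<in> trig_space N"
proof -
  assume "u \<in> trig_space N"
  then obtain c where "u = trig N c"
    by (auto simp: trig_space_iff)
  hence "(\<lambda>x. a * u x) = trig N (\<lambda>k. a * c k)"
    by (simp add: trig_def fun_eq_iff sum_distrib_left mult.assoc)
  thus ?thesis by simp
qed

lemma trig_space_diff: "u \<in> trig_space N \<Longrightarrow> v \<in> trig_space N \<Longrightarrow> (\<lambda>x. u x - v x) \<in> trig_space N"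
  using trig_space_add[OF _ trig_space_mult[of v N "-1"], of u] by simp

lemma proj_in_trig_space [simp, intro]: "proj N u \<in> trig_space N"
  by (simp add: proj_eq_trig)

lemma F_rhs_eq: "F_rhs s N u x = - \<i> * frac_lap s u x + \<i> * proj N (cubic u) x"
  by (simp add: F_rhs_def cubic_def [abs_def])

lemma frac_lap_in_trig_space: "u \<in> trig_space N \<Longrightarrow> frac_lap s u \<in> trig_space N"
  by (simp add: frac_lap_def fourier_mult_trig_space)

lemma F_rhs_in_trig_space:
  assumes "u \<in> trig_space N" shows "F_rhs s N u \<in> trig_space N"
  unfolding F_rhs_eq [abs_def]
  by (intro trig_space_add trig_space_mult frac_lap_in_trig_space assms) auto

text \<open>The factor -i moves to the test function as i, and the projection disappears since i v
  stays in \<open>trig_space N\<close>. Every later estimate tests the stage equation through this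
  identity.\<close>

lemma rip_F_rhs:
  assumes "u \<in> trig_space N" "v \<in> trig_space N"
  shows "rip (F_rhs s N u) v = Dform s N u (\<lambda>x. \<i> * v x) - rip (cubic u) (\<lambda>x. \<i> * v x)"
proof -
  have iv: "(\<lambda>x. \<i> * v x) \<in> trig_space N"
    by (intro trig_space_mult assms)
  have cont: "continuous_on UNIV (\<lambda>x. \<i> * v x)" "continuous_on UNIV (frac_lap s u)"
    "continuous_on UNIV (proj N (cubic u))" "continuous_on UNIV (cubic u)"
    using iv assms by (auto intro!: continuous_on_trig_space frac_lap_in_trig_space continuous_on_cubic)
  have "rip (F_rhs s N u) v = rip (\<lambda>x. frac_lap s u x - proj N (cubic u) x) (\<lambda>x. \<i> * v x)"
    by (simp add: rip_def F_rhs_eq inner_complex_def algebra_simps)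
  also have "\<dots> = rip (frac_lap s u) (\<lambda>x. \<i> * v x) - rip (proj N (cubic u)) (\<lambda>x. \<i> * v x)"
    by (intro rip_diff_left cont)
  finally show ?thesis
    using iv assms cont by (simp add: rip_frac_lap rip_proj)
qed

lemma cmod_trig_space_le:
  assumes "u \<in> trig_space N"
  shows "cmod (u x) \<le> (\<Sum>k\<in>{- int N..int N}. cmod (fourier_coeff u k))"
proof -
  have "u x = trig N (fourier_coeff u) x"
    using proj_trig_space[OF assms] by (simp add: proj_eq_trig)
  also have "cmod \<dots> \<le> (\<Sum>k\<in>{- int N..int N}. cmod (fourier_coeff u k))"
    unfolding trig_def by (rule sum_norm_le) (simp add: norm_mult)
  finally show ?thesis .
qed

lemma rip_self_trig_space:
  assumes "u \<in> trig_space N"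
  shows "rip u u = 2 * pi * (\<Sum>k\<in>{- int N..int N}. (cmod (fourier_coeff u k))\<^sup>2)"
  using rip_trig_space[OF continuous_on_trig_space[OF assms] assms]
  by (simp add: power2_norm_eq_inner)

text \<open>Triangle inequality, then Cauchy-Schwarz over the 2N + 1 frequencies. The constant grows
  with \<open>N\<close>, so this serves only the uniqueness part.\<close>

lemma trig_space_sup_le_L2:
  assumes "u \<in> trig_space N"
  shows "2 * pi * (cmod (u x))\<^sup>2 \<le> (2 * real N + 1) * rip u u"
proof -
  have "(cmod (u x))\<^sup>2 \<le> (\<Sum>k\<in>{- int N..int N}. cmod (fourier_coeff u k))\<^sup>2"
    by (intro power_mono cmod_trig_space_le assms) auto
  also have "\<dots> \<le> (\<Sum>k\<in>{- int N..int N}. (cmod (fourier_coeff u k))\<^sup>2) * card {- int N..int N}"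
    by (rule sum_squared_le_sum_of_squares)
  also have "real (card {- int N..int N}) = 2 * real N + 1"
    by simp
  finally show ?thesis
    unfolding rip_self_trig_space[OF assms] by (simp add: mult_ac)
qed

text \<open>The series converges because 2s > 1, so its tails are small. Having 0 in
  \<open>A\<close> keeps the weights of the remaining frequencies invertible.\<close>

lemma sobolev_tail:
  fixes s \<epsilon> :: real
  assumes "s > 1/2" "\<epsilon> > 0"
  obtains A :: "int set" where "finite A" "0 \<in> A"
    and "\<And>B. finite B \<Longrightarrow> B \<inter> A = {} \<Longrightarrow> (\<Sum>k\<in>B. \<bar>real_of_int k\<bar> powr (- 2 * s)) \<le> \<epsilon>"
proof -
  let ?f = "\<lambda>n. real n powr (- 2 * s)"
  have "summable ?f"
    using assms by (simp add: summable_real_powr_iff)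
  \<comment> \<open>Half of \<open>\<epsilon>\<close> for each sign of the frequency.\<close>
  then obtain M where M: "\<And>m n. m \<ge> M \<Longrightarrow> norm (sum ?f {m..<n}) < \<epsilon> / 2"
    using assms(2) unfolding summable_Cauchy by (meson half_gt_zero)
  show thesis
  proof (rule that[of "{- int M..int M}"])
    fix B :: "int set" assume B: "finite B" "B \<inter> {- int M..int M} = {}"
    \<comment> \<open>A strict bound for all frequencies in \<open>B\<close>; inserting 0 covers the
      empty set.\<close>
    define n where "n = Suc (Max (insert 0 ((\<lambda>k. nat \<bar>k\<bar>) ` B)))"
    have n: "nat \<bar>k\<bar> < n" if "k \<in> B" for k
      unfolding n_def less_Suc_eq_le using B that by (intro Max_ge) auto
    have sub: "B \<subseteq> int ` {M..<n} \<union> (\<lambda>k. - int k) ` {M..<n}"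
    proof
      fix k assume k: "k \<in> B"
      hence "k > int M \<or> k < - int M" using B(2) by force
      thus "k \<in> int ` {M..<n} \<union> (\<lambda>k. - int k) ` {M..<n}"
      proof
        assume "k > int M"
        hence "k = int (nat \<bar>k\<bar>)" "nat \<bar>k\<bar> \<in> {M..<n}" using n[OF k] by auto
        thus ?thesis by blast
      next
        assume "k < - int M"
        hence "k = - int (nat \<bar>k\<bar>)" "nat \<bar>k\<bar> \<in> {M..<n}" using n[OF k] by auto
        thus ?thesis by blast
      qed
    qed
    let ?g = "\<lambda>k::int. \<bar>real_of_int k\<bar> powr (- 2 * s)"
    have "sum ?g B \<le> sum ?g (int ` {M..<n} \<union> (\<lambda>k. - int k) ` {M..<n})"
      using sub by (intro sum_mono2) auto
    also have "\<dots> \<le> sum ?g (int ` {M..<n}) + sum ?g ((\<lambda>k. - int k) ` {M..<n})"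
      by (subst sum.union_inter [symmetric]) (auto intro!: sum_nonneg)
    also have "\<dots> = sum ?f {M..<n} + sum ?f {M..<n}"
      by (subst (1 2) sum.reindex) (auto simp: inj_on_def)
    also have "\<dots> \<le> \<epsilon>"
      using M[of M n] by simp
    finally show "sum ?g B \<le> \<epsilon>" .
  qed auto
qed

text \<open>Split the frequencies at the finite set \<open>A\<close>: the low ones cost a multiple
  of the mass, the high ones are paired with the weight |k|^(-s), whose squares sum to at most
  \<open>\<epsilon>\<close>. As \<open>A\<close> depends only on \<open>s\<close> and
  \<open>\<epsilon>\<close>, the constant is uniform in \<open>N\<close>.\<close>

lemma sobolev_eps:
  fixes s \<epsilon> :: real
  assumes "s > 1/2" "\<epsilon> > 0"
  shows "\<exists>C\<ge>0. \<forall>N. \<forall>u\<in>trig_space N. \<forall>x. (cmod (u x))\<^sup>2 \<le> \<epsilon> * Dform s N u u + C * rip u u"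
proof -
  obtain A :: "int set" where A: "finite A" "0 \<in> A"
    and tail: "\<And>B. finite B \<Longrightarrow> B \<inter> A = {} \<Longrightarrow> (\<Sum>k\<in>B. \<bar>real_of_int k\<bar> powr (- 2 * s)) \<le> \<epsilon>"
    using sobolev_tail[OF assms] by blast
  show ?thesis
  \<comment> \<open>Cauchy-Schwarz over the low frequencies costs their number.\<close>
  proof (rule exI[of _ "real (card A)"], intro conjI allI ballI)
    fix N u x assume u: "u \<in> trig_space N"
    let ?I = "{- int N..int N}" and ?a = "\<lambda>k. cmod (fourier_coeff u k)"
    have "(\<Sum>k\<in>?I \<inter> A. ?a k)\<^sup>2 \<le> (\<Sum>k\<in>?I \<inter> A. (?a k)\<^sup>2) * card (?I \<inter> A)"
      by (rule sum_squared_le_sum_of_squares)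
    also have "\<dots> \<le> (\<Sum>k\<in>?I. (?a k)\<^sup>2) * card A"
      using A by (intro mult_mono sum_mono2 of_nat_mono card_mono) (auto intro: sum_nonneg)
    finally have low: "(\<Sum>k\<in>?I \<inter> A. ?a k)\<^sup>2 \<le> (\<Sum>k\<in>?I. (?a k)\<^sup>2) * card A" .
    have "(\<Sum>k\<in>?I - A. ?a k) = (\<Sum>k\<in>?I - A. \<bar>real_of_int k\<bar> powr (-s) * (\<bar>real_of_int k\<bar> powr s * ?a k))"
    proof (intro sum.cong refl)
      fix k assume "k \<in> ?I - A"
      hence "k \<noteq> 0" using A(2) by auto
      thus "?a k = \<bar>real_of_int k\<bar> powr (-s) * (\<bar>real_of_int k\<bar> powr s * ?a k)"
        by (simp add: powr_minus)
    qed
    hence "(\<Sum>k\<in>?I - A. ?a k)\<^sup>2 \<le> (\<Sum>k\<in>?I - A. (\<bar>real_of_int k\<bar> powr (-s))\<^sup>2)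
        * (\<Sum>k\<in>?I - A. (\<bar>real_of_int k\<bar> powr s * ?a k)\<^sup>2)"
      by (simp only: Cauchy_Schwarz_ineq_sum)
    also have "\<dots> \<le> \<epsilon> * (\<Sum>k\<in>?I. \<bar>real_of_int k\<bar> powr (2 * s) * (?a k)\<^sup>2)"
    proof (intro mult_mono)
      have "(\<bar>real_of_int k\<bar> powr (-s))\<^sup>2 = \<bar>real_of_int k\<bar> powr (- 2 * s)" for k
        by (simp add: power2_eq_square powr_add [symmetric])
      thus "(\<Sum>k\<in>?I - A. (\<bar>real_of_int k\<bar> powr (-s))\<^sup>2) \<le> \<epsilon>"
        using tail[of "?I - A"] by auto
      have "(\<bar>real_of_int k\<bar> powr s * y)\<^sup>2 = \<bar>real_of_int k\<bar> powr (2 * s) * y\<^sup>2" for k y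
        by (simp add: power_mult_distrib) (simp add: power2_eq_square powr_add [symmetric])
      thus "(\<Sum>k\<in>?I - A. (\<bar>real_of_int k\<bar> powr s * ?a k)\<^sup>2) \<le> (\<Sum>k\<in>?I. \<bar>real_of_int k\<bar> powr (2 * s) * (?a k)\<^sup>2)"
        by (simp, intro sum_mono2) auto
    qed (use assms in \<open>auto intro!: sum_nonneg\<close>)
    finally have high: "(\<Sum>k\<in>?I - A. ?a k)\<^sup>2 \<le> \<epsilon> * (\<Sum>k\<in>?I. \<bar>real_of_int k\<bar> powr (2 * s) * (?a k)\<^sup>2)" .
    have "(\<Sum>k\<in>?I. ?a k) = (\<Sum>k\<in>?I \<inter> A. ?a k) + (\<Sum>k\<in>?I - A. ?a k)"
      by (subst sum.union_disjoint [symmetric]) (auto intro!: sum.cong)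
    hence "(cmod (u x))\<^sup>2 \<le> ((\<Sum>k\<in>?I \<inter> A. ?a k) + (\<Sum>k\<in>?I - A. ?a k))\<^sup>2"
      using cmod_trig_space_le[OF u, of x] by (intro power_mono) auto
    also have "\<dots> \<le> 2 * (\<Sum>k\<in>?I \<inter> A. ?a k)\<^sup>2 + 2 * (\<Sum>k\<in>?I - A. ?a k)\<^sup>2"
      using sum_squares_bound[of "\<Sum>k\<in>?I \<inter> A. ?a k" "\<Sum>k\<in>?I - A. ?a k"]
      by (simp add: power2_sum)
    \<comment> \<open>The factor 2 from squaring a sum is absorbed by the Parseval factor 2
      pi.\<close>
    also have "\<dots> \<le> 2 * pi * ((\<Sum>k\<in>?I \<inter> A. ?a k)\<^sup>2 + (\<Sum>k\<in>?I - A. ?a k)\<^sup>2)"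
      using pi_ge_two by (auto simp: distrib_left intro!: add_mono mult_right_mono)
    also have "\<dots> \<le> 2 * pi * ((\<Sum>k\<in>?I. (?a k)\<^sup>2) * card A + \<epsilon> * (\<Sum>k\<in>?I. \<bar>real_of_int k\<bar> powr (2 * s) * (?a k)\<^sup>2))"
      by (intro mult_left_mono add_mono low high) auto
    also have "\<dots> = \<epsilon> * Dform s N u u + card A * rip u u"
      by (simp add: Dform_def rip_self_trig_space[OF u] power2_norm_eq_inner algebra_simps)
    finally show "(cmod (u x))\<^sup>2 \<le> \<epsilon> * Dform s N u u + card A * rip u u" .
  qed auto
qed

section \<open>The Hamiltonian and the midpoint step\<close>

lemma cubic_bound:
  assumes "(cmod (u x))\<^sup>2 \<le> m"
  shows "\<bar>cubic u x \<bullet> z\<bar> \<le> (m / 2) * (cmod (u x))\<^sup>2 + (m / 2) * (cmod z)\<^sup>2"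
proof -
  have "\<bar>cubic u x \<bullet> z\<bar> \<le> (cmod (u x))\<^sup>2 * (cmod (u x) * cmod z)"
    using Cauchy_Schwarz_ineq2[of "cubic u x" z] by (simp add: cubic_def norm_mult norm_power mult.assoc)
  also have "\<dots> \<le> m * (((cmod (u x))\<^sup>2 + (cmod z)\<^sup>2) / 2)"
    using assms sum_squares_bound[of "cmod (u x)" "cmod z"]
    by (intro mult_mono) (auto intro: order_trans[OF zero_le_power2])
  finally show ?thesis by (simp add: algebra_simps)
qed

lemma rip_cubic_abs_le:
  assumes "continuous_on UNIV u" "continuous_on UNIV v" "\<And>x. (cmod (u x))\<^sup>2 \<le> m"
  shows "\<bar>rip (cubic u) v\<bar> \<le> m / 2 * (rip u u + rip v v)"
proof -
  have "rip (cubic u) v \<le> (m / 2) * rip u u + (m / 2) * rip v v"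
  proof (rule rip_le)
    show "cubic u x \<bullet> v x \<le> (m / 2) * (cmod (u x))\<^sup>2 + (m / 2) * (cmod (v x))\<^sup>2" for x
      using cubic_bound[of u x m "v x"] assms(3) by simp
  qed (intro continuous_on_cubic assms)+
  moreover have "rip (cubic u) (\<lambda>x. - v x) \<le> (m / 2) * rip u u + (m / 2) * rip v v"
  proof (rule rip_le)
    show "cubic u x \<bullet> - v x \<le> (m / 2) * (cmod (u x))\<^sup>2 + (m / 2) * (cmod (v x))\<^sup>2" for x
      using cubic_bound[of u x m "- v x"] assms(3) by simp
  qed (intro continuous_on_cubic continuous_on_minus assms)+
  moreover have "rip (cubic u) (\<lambda>x. - v x) = - rip (cubic u) v"
    by (simp add: rip_def)
  ultimately show ?thesis by (simp add: abs_le_iff algebra_simps)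
qed

section \<open>Quartic part of the Hamiltonian and coercivity\<close>

definition quartic :: "(real \<Rightarrow> complex) \<Rightarrow> real" where
  "quartic u = integral {-pi..pi} (\<lambda>x. (cmod (u x)) ^ 4)"

lemma Ham_eq:
  assumes "u \<in> trig_space N"
  shows "Ham s u = Dform s N u u / 2 - quartic u / 4"
proof -
  have "continuous_on UNIV (abs_D s u)"
    unfolding abs_D_def by (rule continuous_on_trig_space[OF frac_lap_in_trig_space[OF assms]])
  moreover have "continuous_on UNIV u"
    using assms by (rule continuous_on_trig_space)
  ultimately have "Ham s u = 1/2 * (rip (abs_D s u) (abs_D s u) - 1/2 * quartic u)"
    unfolding Ham_def rip_self_eq quartic_def
    by (subst integral_diff) (auto intro!: integrable_period continuous_intros)
  thus ?thesis by (simp add: rip_abs_D[OF assms] field_simps)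
qed

lemma quartic_nonneg: "continuous_on UNIV u \<Longrightarrow> 0 \<le> quartic u"
  unfolding quartic_def by (intro integral_nonneg integrable_period continuous_intros) auto

text \<open>The quartic term enters with a minus sign, so dropping it only raises the energy. This
  bounds the initial energy from above.\<close>

lemma Ham_le_Dform: "u \<in> trig_space N \<Longrightarrow> Ham s u \<le> Dform s N u u / 2"
  using quartic_nonneg[OF continuous_on_trig_space, of u N] by (simp add: Ham_eq)

lemma quartic_le:
  assumes "continuous_on UNIV u" "\<And>x. (cmod (u x))\<^sup>2 \<le> m"
  shows "quartic u \<le> m * rip u u"
proof -
  have "quartic u \<le> integral {-pi..pi} (\<lambda>x. m * (cmod (u x))\<^sup>2)"
    unfolding quartic_def
  proof (rule integral_mono_period)
    show "(cmod (u x)) ^ 4 \<le> m * (cmod (u x))\<^sup>2" for x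
      using mult_right_mono[OF assms(2)[of x], of "(cmod (u x))\<^sup>2"]
      by (simp add: power4_eq_xxxx power2_eq_square mult.assoc)
  qed (intro continuous_intros assms)+
  thus ?thesis by (simp add: rip_self_eq)
qed

text \<open>For \<open>s > 1/2\<close> the quartic term is absorbed by an arbitrarily small part of the quadratic one.\<close>
lemma Ham_coercive:
  assumes "s > 1/2" "K \<ge> 0"
  obtains C where "C \<ge> 0"
    and "\<And>N u. u \<in> trig_space N \<Longrightarrow> rip u u \<le> K \<Longrightarrow> Dform s N u u \<le> 4 * Ham s u + C"
proof -
  \<comment> \<open>With mass at most \<open>K\<close> the quartic term then carries the coefficient
    K/(K+1) < 1 of \<open>Dform\<close>; since \<open>4 * Ham\<close> is twice \<open>Dform\<close>
    minus the quartic term, one copy of \<open>Dform\<close> is left over.\<close>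
  have "1 / (K + 1) > 0" using assms by simp
  from sobolev_eps[OF assms(1) this] obtain C where C: "C \<ge> 0"
    "\<And>N u x. u \<in> trig_space N \<Longrightarrow> (cmod (u x))\<^sup>2 \<le> 1 / (K + 1) * Dform s N u u + C * rip u u"
    by blast
  show thesis
  proof (rule that[of "C * K\<^sup>2"])
    fix N u assume u: "u \<in> trig_space N" "rip u u \<le> K"
    have c: "continuous_on UNIV u" using u by (rule_tac continuous_on_trig_space)
    note [simp] = rip_self_nonneg[OF c] Dform_nonneg
    have "quartic u \<le> (1 / (K + 1) * Dform s N u u + C * rip u u) * rip u u"
      by (rule quartic_le[OF c C(2)[OF u(1)]])
    also have "\<dots> \<le> (1 / (K + 1) * Dform s N u u + C * K) * K"
      using u C assms by (intro mult_mono add_mono order_refl) auto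
    also have "\<dots> = K / (K + 1) * Dform s N u u + C * K\<^sup>2"
      by (simp add: algebra_simps power2_eq_square)
    also have "\<dots> \<le> 1 * Dform s N u u + C * K\<^sup>2"
      using assms by (intro add_mono mult_right_mono) auto
    finally show "Dform s N u u \<le> 4 * Ham s u + C * K\<^sup>2"
      by (simp add: Ham_eq[OF u(1)])
  qed (use C in auto)
qed

text \<open>Since \<open>d\<close> is half of the increment, \<open>h\<close> is half of the
  substep. In terms of \<open>w\<close> the implicit stage becomes an explicit formula for
  \<open>d\<close>. The sign of \<open>h\<close> is free, because triple-jump coefficients can be
  negative.\<close>

locale midpoint_step =
  fixes s :: real and N :: nat and h :: real and w d :: "real \<Rightarrow> complex"
  assumes w: "w \<in> trig_space N"
    and d_eq: "d = (\<lambda>x. complex_of_real h * F_rhs s N w x)"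
begin

lemma d: "d \<in> trig_space N"
  unfolding d_eq by (intro trig_space_mult F_rhs_in_trig_space w)

lemma cont_w: "continuous_on UNIV w" and cont_d: "continuous_on UNIV d"
  using w d by (auto intro: continuous_on_trig_space)

lemmas conts = cont_w cont_d continuous_on_add[OF cont_w cont_d] continuous_on_diff[OF cont_w cont_d]

lemma rip_d:
  assumes "v \<in> trig_space N"
  shows "rip d v = h * (Dform s N w (\<lambda>x. \<i> * v x) - rip (cubic w) (\<lambda>x. \<i> * v x))"
  unfolding d_eq rip_scale_left by (simp add: rip_F_rhs[OF w assms])

text \<open>Phase invariance: \<open>cubic w\<close> is pointwise a real multiple of
  \<open>w\<close>, and the Fourier symbol is real, so both terms of the equation tested with
  \<open>w\<close> vanish.\<close>

lemma rip_w_d: "rip w d = 0"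
proof -
  have "rip (cubic w) (\<lambda>x. \<i> * w x) = 0"
    by (simp add: rip_def cubic_def inner_complex_def algebra_simps)
  moreover have "Dform s N w (\<lambda>x. \<i> * w x) = 0"
    using Dform_i Dform_commute by metis
  ultimately show ?thesis using rip_d[OF w] by (simp add: rip_commute)
qed

text \<open>Pythagoras, by \<open>rip_w_d\<close>. Together with \<open>rip_diff\<close> it says
  that both ends of a stage have the same mass.\<close>

lemma rip_add: "rip (\<lambda>x. w x + d x) (\<lambda>x. w x + d x) = rip w w + rip d d"
  using rip_w_d conts
  by (simp add: rip_add_left rip_add_right rip_commute[of d w])

lemma rip_diff: "rip (\<lambda>x. w x - d x) (\<lambda>x. w x - d x) = rip w w + rip d d"
  using rip_w_d conts
  by (simp add: rip_diff_left rip_diff_right rip_commute[of d w])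

text \<open>\<open>d\<close> is tangent to the level set of the Hamiltonian at \<open>w\<close>.\<close>
lemma Dform_w_d: "Dform s N w d = rip (cubic w) d"
proof (cases "h = 0")
  case True
  thus ?thesis by (simp add: d_eq Dform_def fourier_coeff_def rip_def)
next
  case False
  have id: "(\<lambda>x. \<i> * d x) \<in> trig_space N" by (intro trig_space_mult d)
  have "rip d (\<lambda>x. \<i> * d x) = 0"
    by (simp add: rip_def inner_complex_def)
  moreover have ii: "(\<lambda>x. \<i> * (\<i> * d x)) = (\<lambda>x. complex_of_real (-1) * d x)"
    by (simp add: mult.assoc [symmetric])
  ultimately have "0 = h * (- Dform s N w d + rip (cubic w) d)"
    using rip_d[OF id]
    unfolding ii Dform_commute[of s N w] rip_commute[of "cubic w"] Dform_scale rip_scale_left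
    by simp
  thus ?thesis using False by simp
qed

text \<open>Trades the pairing of \<open>w\<close> with the unknown \<open>d\<close> for a cubic
  term, which mass and supremum of \<open>w\<close> control. This is the source of the a priori
  bound on the midpoint.\<close>

lemma Dform_w: "Dform s N w w = Dform s N (\<lambda>x. w x - d x) w + rip (cubic w) d"
  using Dform_w_d by (simp add: Dform_diff_left[OF cont_w cont_d] Dform_commute[of s N d w])

lemma Dform_add: "Dform s N (\<lambda>x. w x + d x) (\<lambda>x. w x + d x)
    = Dform s N w w + 2 * rip (cubic w) d + Dform s N d d"
  using Dform_w_d conts
  by (simp add: Dform_add_left Dform_add_right Dform_commute[of s N d w])

lemma Dform_diff: "Dform s N (\<lambda>x. w x - d x) (\<lambda>x. w x - d x)
    = Dform s N w w - 2 * rip (cubic w) d + Dform s N d d"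
  using Dform_w_d conts
  by (simp add: Dform_diff_left Dform_diff_right Dform_commute[of s N d w])

text \<open>Write the fourth powers as squares of |w|^2 + |d|^2 +- 2 (w, d) and take their
  difference. The part with |w|^2 is the one that cancels in \<open>Ham_add\<close>.\<close>

lemma quartic_add: "quartic (\<lambda>x. w x + d x) = quartic (\<lambda>x. w x - d x)
    + 8 * (rip (cubic w) d + rip (\<lambda>x. complex_of_real ((cmod (d x))\<^sup>2) * w x) d)"
proof -
  let ?e = "\<lambda>x. complex_of_real ((cmod (d x))\<^sup>2) * w x"
  have "(cmod (a + b)) ^ 4 - (cmod (a - b)) ^ 4
      = 8 * ((cmod a)\<^sup>2 * (a \<bullet> b) + (cmod b)\<^sup>2 * (a \<bullet> b))" for a b :: complex
  proof -
    have "(cmod (a + b)) ^ 4 = ((cmod a)\<^sup>2 + (cmod b)\<^sup>2 + 2 * (a \<bullet> b))\<^sup>2"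
         "(cmod (a - b)) ^ 4 = ((cmod a)\<^sup>2 + (cmod b)\<^sup>2 - 2 * (a \<bullet> b))\<^sup>2"
        using power_mult[of "cmod (a + b)" 2 2] power_mult[of "cmod (a - b)" 2 2]
      by (simp_all add: power2_norm_eq_inner inner_add_left inner_add_right inner_diff_left
            inner_diff_right inner_commute algebra_simps)
    thus ?thesis by (simp add: power2_eq_square algebra_simps)
  qed
  hence eq: "(cmod (w x + d x)) ^ 4 - (cmod (w x - d x)) ^ 4 = 8 * (cubic w x \<bullet> d x + ?e x \<bullet> d x)" for x
    by (simp add: cubic_def scaleR_conv_of_real [symmetric] del: of_real_power)
  have "quartic (\<lambda>x. w x + d x) - quartic (\<lambda>x. w x - d x)
      = integral {-pi..pi} (\<lambda>x. (cmod (w x + d x)) ^ 4 - (cmod (w x - d x)) ^ 4)"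
    unfolding quartic_def
    by (subst integral_diff) (auto intro!: integrable_period continuous_intros conts)
  also have "\<dots> = 8 * (rip (cubic w) d + rip ?e d)"
    unfolding eq rip_def integral_mult_right
    by (subst integral_add [symmetric])
      (auto intro!: integrable_period continuous_intros conts continuous_on_cubic)
  finally show ?thesis by simp
qed

text \<open>The quadratic form contributes 4/2 and the quartic term -8/4 times
  \<open>rip (cubic w) d\<close>; these cancel, and only the term of third order in \<open>d\<close>
  survives.\<close>

lemma Ham_add: "Ham s (\<lambda>x. w x + d x) = Ham s (\<lambda>x. w x - d x)
    - 2 * rip (\<lambda>x. complex_of_real ((cmod (d x))\<^sup>2) * w x) d"
  using trig_space_add[OF w d] trig_space_diff[OF w d]
  by (simp add: Ham_eq Dform_add Dform_diff quartic_add del: of_real_power) (simp add: field_simps)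

lemma Ham_add_le:
  assumes "\<And>x. cmod (w x) \<le> a" "\<And>x. cmod (d x) \<le> c"
  shows "Ham s (\<lambda>x. w x + d x) \<le> Ham s (\<lambda>x. w x - d x) + 2 * a * c * rip d d"
proof -
  have "rip (\<lambda>x. complex_of_real ((cmod (d x))\<^sup>2) * w x) (\<lambda>x. - d x) \<le> (a * c) * rip d d + 0 * rip d d"
  proof (rule rip_le)
    fix x
    have "(complex_of_real ((cmod (d x))\<^sup>2) * w x) \<bullet> - d x
        \<le> cmod (complex_of_real ((cmod (d x))\<^sup>2) * w x) * cmod (- d x)"
      by (rule norm_cauchy_schwarz)
    also have "\<dots> = (cmod (d x))\<^sup>2 * (cmod (w x) * cmod (d x))"
      by (simp add: norm_mult norm_power)
    also have "\<dots> \<le> (cmod (d x))\<^sup>2 * (a * c)"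
      using order_trans[OF norm_ge_zero assms(1)] by (intro mult_left_mono mult_mono assms) auto
    finally show "(complex_of_real ((cmod (d x))\<^sup>2) * w x) \<bullet> - d x
        \<le> (a * c) * (cmod (d x))\<^sup>2 + 0 * (cmod (d x))\<^sup>2"
      by (simp add: mult_ac)
  qed (intro continuous_intros conts)+
  thus ?thesis by (simp add: Ham_add rip_def)
qed

text \<open>A quarter of \<open>Dform s N w w\<close> arises from Young's inequality in
  \<open>Dform_w\<close> and is absorbed on the left.\<close>

lemma Dform_w_le:
  assumes "\<And>x. (cmod (w x))\<^sup>2 \<le> m"
  shows "3 * Dform s N w w \<le> 4 * Dform s N (\<lambda>x. w x - d x) (\<lambda>x. w x - d x) + 2 * (m * (rip w w + rip d d))"
proof -
  have "rip (cubic w) d \<le> (m * (rip w w + rip d d)) / 2"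
    using rip_cubic_abs_le[OF cont_w cont_d assms] by simp
  moreover have "Dform s N (\<lambda>x. w x - d x) w
      \<le> Dform s N (\<lambda>x. w x - d x) (\<lambda>x. w x - d x) + Dform s N w w / 4"
    using Dform_young[of 1 s N "\<lambda>x. w x - d x" w] by simp
  ultimately show ?thesis using Dform_w by linarith
qed

text \<open>Solve \<open>Dform_diff\<close> for the form of \<open>d\<close> and drop the
  nonnegative form of \<open>w\<close>.\<close>

lemma Dform_d_le:
  assumes "\<And>x. (cmod (w x))\<^sup>2 \<le> m"
  shows "Dform s N d d \<le> Dform s N (\<lambda>x. w x - d x) (\<lambda>x. w x - d x) + m * (rip w w + rip d d)"
  using Dform_diff Dform_nonneg[of s N w] rip_cubic_abs_le[OF cont_w cont_d assms]
  by simp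

text \<open>Test the stage equation with \<open>d\<close> itself: the prefactor \<open>h\<close>
  stays outside, which is where smallness of \<open>d\<close> comes from.\<close>

lemma rip_d_le:
  assumes "\<And>x. (cmod (w x))\<^sup>2 \<le> m"
  shows "rip d d \<le> \<bar>h\<bar> * ((Dform s N w w + Dform s N d d) / 2 + m / 2 * (rip w w + rip d d))"
proof -
  have "rip (\<lambda>x. \<i> * d x) (\<lambda>x. \<i> * d x) = rip d d"
    by (simp add: rip_def inner_complex_def add.commute)
  hence "\<bar>rip (cubic w) (\<lambda>x. \<i> * d x)\<bar> \<le> m / 2 * (rip w w + rip d d)"
    using rip_cubic_abs_le[OF cont_w _ assms, of "\<lambda>x. \<i> * d x"]
    by (simp add: continuous_on_mult_const conts continuous_on_mult)
  moreover have "\<bar>Dform s N w (\<lambda>x. \<i> * d x)\<bar> \<le> (Dform s N w w + Dform s N d d) / 2"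
    using Dform_abs_le[of s N w "\<lambda>x. \<i> * d x"] by (simp add: Dform_i_self)
  ultimately have "\<bar>Dform s N w (\<lambda>x. \<i> * d x) - rip (cubic w) (\<lambda>x. \<i> * d x)\<bar>
      \<le> (Dform s N w w + Dform s N d d) / 2 + m / 2 * (rip w w + rip d d)" (is "\<bar>?x\<bar> \<le> ?y")
    by linarith
  hence "\<bar>h * ?x\<bar> \<le> \<bar>h\<bar> * ?y"
    by (simp add: abs_mult mult_left_mono)
  thus ?thesis using rip_d[OF d] by simp
qed

end

text \<open>The bounds on \<open>w\<close> and \<open>Dform d d\<close> need no smallness of \<open>h\<close>; smallness enters only through the
  supremum of \<open>d\<close>, after \<open>rip d d = O(h)\<close>.\<close>
lemma energy_step:
  fixes s K B \<eta> :: real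
  assumes "s > 1/2" "K \<ge> 0" "B \<ge> 0" "\<eta> > 0"
  obtains \<delta> where "\<delta> > 0"
    and "\<And>N h w d. midpoint_step s N h w d \<Longrightarrow> \<bar>h\<bar> \<le> \<delta> \<Longrightarrow> rip w w + rip d d \<le> K \<Longrightarrow>
      Dform s N (\<lambda>x. w x - d x) (\<lambda>x. w x - d x) \<le> B \<Longrightarrow>
      Ham s (\<lambda>x. w x + d x) \<le> Ham s (\<lambda>x. w x - d x) + \<eta> * \<bar>h\<bar>"
proof -
  \<comment> \<open>This weight makes the cubic contribution in \<open>Dform_w_le\<close> at most
    twice \<open>Dform s N w w\<close>, against three copies on the left.\<close>
  have "1 / (K + 1) > 0" using assms by simp
  from sobolev_eps[OF assms(1) this] obtain C0 where C0: "C0 \<ge> 0"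
    "\<And>N u x. u \<in> trig_space N \<Longrightarrow> (cmod (u x))\<^sup>2 \<le> 1 / (K + 1) * Dform s N u u + C0 * rip u u"
    by blast
  \<comment> \<open>In turn these will bound \<open>Dform\<close> of \<open>w\<close>, the square of
    the supremum of \<open>w\<close>, \<open>Dform\<close> of \<open>d\<close>, and
    \<open>rip d d\<close> per unit of \<open>\<bar>h\<bar>\<close>. None involves \<open>N\<close>
    or \<open>h\<close>.\<close>
  define W where "W = 4 * B + 2 * C0 * K\<^sup>2"
  define m where "m = W + C0 * K"
  define V where "V = B + m * K"
  define Q where "Q = (W + V) / 2 + m / 2 * K"
  have nn: "W \<ge> 0" "m \<ge> 0" "V \<ge> 0" "Q \<ge> 0"
    using assms C0 by (auto simp: W_def m_def V_def Q_def)
  \<comment> \<open>The target for the supremum of \<open>d\<close>: small enough that the defect 2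
    sqrt(m) c Q stays below \<open>\<eta>\<close>; the 1 guards against a zero denominator.\<close>
  define c where "c = \<eta> / (2 * sqrt m * Q + 1)"
  have "2 * sqrt m * Q + 1 > 0" using nn by (intro add_nonneg_pos) auto
  hence c: "c > 0" "2 * sqrt m * c * Q \<le> \<eta>"
    using assms by (auto simp: c_def field_simps)
  \<comment> \<open>Half of \<open>c\<^sup>2\<close> is reserved for the \<open>Dform\<close> part
    of the supremum bound; the choice of \<open>\<delta>\<close> takes care of the other
    half.\<close>
  have "c\<^sup>2 / (2 * (V + 1)) > 0" using c nn by simp
  from sobolev_eps[OF assms(1) this] obtain C1 where C1: "C1 \<ge> 0"
    "\<And>N u x. u \<in> trig_space N \<Longrightarrow> (cmod (u x))\<^sup>2 \<le> c\<^sup>2 / (2 * (V + 1)) * Dform s N u u + C1 * rip u u"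
    by blast
  define \<delta> where "\<delta> = c\<^sup>2 / (2 * (C1 * Q + 1))"
  have C1Q: "C1 * Q \<ge> 0" using C1 nn by auto
  show thesis
  proof (rule that[of \<delta>])
    show "\<delta> > 0" using c C1Q by (auto simp: \<delta>_def intro!: divide_pos_pos add_nonneg_pos)
    fix N h w d
    assume "midpoint_step s N h w d" and h: "\<bar>h\<bar> \<le> \<delta>" and K: "rip w w + rip d d \<le> K"
      and B: "Dform s N (\<lambda>x. w x - d x) (\<lambda>x. w x - d x) \<le> B"
    then interpret midpoint_step s N h w d by simp
    note [simp] = Dform_nonneg[of s N]
    have r: "rip w w \<ge> 0" "rip d d \<ge> 0" using conts by (auto intro: rip_self_nonneg)
    \<comment> \<open>The bound on the supremum of \<open>w\<close> involves the form of
      \<open>w\<close>, which \<open>Dform_w_le\<close> in turn bounds through the supremum. Using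
      \<open>\<mu>\<close> first and absorbing breaks this circle.\<close>
    define \<mu> where "\<mu> = 1 / (K + 1) * Dform s N w w + C0 * rip w w"
    have \<mu>: "(cmod (w x))\<^sup>2 \<le> \<mu>" for x
      using C0(2)[OF w] by (simp add: \<mu>_def)
    have "\<mu> * (rip w w + rip d d) \<le> (1 / (K + 1) * Dform s N w w + C0 * K) * K"
      unfolding \<mu>_def using C0 K r assms by (intro mult_mono add_mono order_refl) auto
    also have "\<dots> = K / (K + 1) * Dform s N w w + C0 * K\<^sup>2"
      by (simp add: algebra_simps power2_eq_square)
    also have "\<dots> \<le> 1 * Dform s N w w + C0 * K\<^sup>2"
      using assms by (intro add_mono mult_right_mono) auto
    finally have "Dform s N w w \<le> W"
      using Dform_w_le[OF \<mu>] B by (simp add: W_def)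
    moreover have "1 / (K + 1) * Dform s N w w \<le> 1 * Dform s N w w"
      using assms by (intro mult_right_mono) auto
    moreover have "C0 * rip w w \<le> C0 * K"
      using K r C0 by (intro mult_left_mono) auto
    ultimately have W: "Dform s N w w \<le> W" and "\<mu> \<le> m"
      by (auto simp: \<mu>_def m_def)
    hence m: "(cmod (w x))\<^sup>2 \<le> m" for x using \<mu>[of x] by simp
    have mK: "m * (rip w w + rip d d) \<le> m * K"
      using K nn by (intro mult_left_mono) auto
    have V: "Dform s N d d \<le> V"
      using Dform_d_le[OF m] B mK by (simp add: V_def)
    have "rip d d \<le> \<bar>h\<bar> * ((Dform s N w w + Dform s N d d) / 2 + m / 2 * (rip w w + rip d d))"
      by (rule rip_d_le[OF m])
    also have "\<dots> \<le> \<bar>h\<bar> * Q"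
      unfolding Q_def using K nn
      by (intro mult_left_mono[OF _ abs_ge_zero] add_mono divide_right_mono V W mult_left_mono[OF K]) auto
    finally have Q: "rip d d \<le> \<bar>h\<bar> * Q" .
    have "(cmod (d x))\<^sup>2 \<le> c\<^sup>2" for x
    proof -
      have "(cmod (d x))\<^sup>2 \<le> c\<^sup>2 / (2 * (V + 1)) * Dform s N d d + C1 * rip d d"
        by (rule C1(2)[OF d])
      also have "\<dots> \<le> c\<^sup>2 / (2 * (V + 1)) * (V + 1) + C1 * (\<delta> * Q)"
        using V Q C1 nn h by (intro add_mono mult_left_mono order_trans[OF Q mult_right_mono]) auto
      also have "\<dots> = c\<^sup>2 / 2 + c\<^sup>2 / 2 * (C1 * Q / (C1 * Q + 1))"
      proof -
        have "c\<^sup>2 / (2 * (V + 1)) * (V + 1) = c\<^sup>2 / 2"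
          using nn by (simp add: divide_simps)
        moreover have "C1 * (\<delta> * Q) = c\<^sup>2 / 2 * (C1 * Q / (C1 * Q + 1))"
          by (simp add: \<delta>_def)
        ultimately show ?thesis by simp
      qed
      also have "\<dots> \<le> c\<^sup>2 / 2 + c\<^sup>2 / 2 * 1"
        using C1Q by (intro add_mono mult_left_mono) auto
      finally show ?thesis by simp
    qed
    hence dc: "cmod (d x) \<le> c" for x
      using c by (meson less_imp_le power2_le_imp_le)
    have wm: "cmod (w x) \<le> sqrt m" for x
      using m real_le_rsqrt by blast
    have "2 * sqrt m * c * rip d d \<le> 2 * sqrt m * c * (\<bar>h\<bar> * Q)"
      using Q c nn by (intro mult_left_mono) auto
    also have "\<dots> = (2 * sqrt m * c * Q) * \<bar>h\<bar>" by simp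
    also have "\<dots> \<le> \<eta> * \<bar>h\<bar>"
      by (intro mult_right_mono c) auto
    finally show "Ham s (\<lambda>x. w x + d x) \<le> Ham s (\<lambda>x. w x - d x) + \<eta> * \<bar>h\<bar>"
      using Ham_add_le[OF wm dc] by simp
  qed
qed

section \<open>Stages of the scheme\<close>

lemma midpoint_stage:
  assumes Y: "Y0 \<in> trig_space N" "Y1 \<in> trig_space N"
    and eq: "Y1 = (\<lambda>x. Y0 x + complex_of_real (2 * h) * F_rhs s N (\<lambda>y. (Y1 y + Y0 y) / 2) x)"
  defines "w \<equiv> \<lambda>x. (Y1 x + Y0 x) / 2" and "d \<equiv> \<lambda>x. (Y1 x - Y0 x) / 2"
  shows "midpoint_step s N h w d" and "(\<lambda>x. w x - d x) = Y0" and "(\<lambda>x. w x + d x) = Y1"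
proof -
  show "midpoint_step s N h w d"
  proof
    show "w \<in> trig_space N"
      using trig_space_mult[OF trig_space_add[OF Y(2,1)], of "1/2"] by (simp add: w_def)
    have "Y1 x - Y0 x = complex_of_real (2 * h) * F_rhs s N w x" for x
      using fun_cong[OF eq, of x] by (simp add: w_def)
    thus "d = (\<lambda>x. complex_of_real h * F_rhs s N w x)"
      by (simp add: d_def fun_eq_iff)
  qed
  show "(\<lambda>x. w x - d x) = Y0" "(\<lambda>x. w x + d x) = Y1"
    by (simp_all add: w_def d_def fun_eq_iff field_simps)
qed

text \<open>Shifts the stage index to start at 0 and writes the substep as twice its half, the shape
  that \<open>midpoint_stage\<close> expects.\<close>

lemma fully_discrete_stage:
  assumes "fully_discrete s N p k M U Y" "n < M" "j < stages p"
  shows "Y n (Suc j) = (\<lambda>x. Y n j x + complex_of_real (2 * (k * bcoef p (Suc j) / 2)) *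
      F_rhs s N (\<lambda>y. (Y n (Suc j) y + Y n j y) / 2) x)"
    and "Y n j \<in> trig_space N" and "Y n (Suc j) \<in> trig_space N"
proof -
  have "Suc j \<in> {1..stages p}" using assms(3) by simp
  hence "Y n (Suc j) = (\<lambda>x. Y n (Suc j - 1) x + complex_of_real (k * bcoef p (Suc j)) *
      F_rhs s N (\<lambda>y. (Y n (Suc j) y + Y n (Suc j - 1) y) / 2) x)"
    using assms(1,2) unfolding fully_discrete_def by blast
  thus "Y n (Suc j) = (\<lambda>x. Y n j x + complex_of_real (2 * (k * bcoef p (Suc j) / 2)) *
      F_rhs s N (\<lambda>y. (Y n (Suc j) y + Y n j y) / 2) x)"
    by simp
  show "Y n j \<in> trig_space N" "Y n (Suc j) \<in> trig_space N"
    using assms unfolding fully_discrete_def by auto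
qed

lemma fully_discrete_midpoint:
  assumes "fully_discrete s N p k M U Y" "n < M" "j < stages p"
  obtains w d where "midpoint_step s N (k * bcoef p (Suc j) / 2) w d"
    and "Y n j = (\<lambda>x. w x - d x)" and "Y n (Suc j) = (\<lambda>x. w x + d x)"
proof -
  note m = midpoint_stage[OF fully_discrete_stage(2,3,1)[OF assms]]
  show thesis by (rule that[OF m(1) m(2,3) [symmetric]])
qed

lemma fully_discrete_endpoints:
  assumes "fully_discrete s N p k M U Y" "n < M"
  shows "Y n 0 = U n" "U (Suc n) = Y n (stages p)"
  using assms by (auto simp: fully_discrete_def)

lemma fully_discrete_mass_stage:
  assumes "fully_discrete s N p k M U Y" "n < M" "j \<le> stages p"
  shows "rip (Y n j) (Y n j) = rip (U n) (U n)"
  using assms(3)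
proof (induction j)
  case (Suc j)
  obtain w d where m: "midpoint_step s N (k * bcoef p (Suc j) / 2) w d"
    "Y n j = (\<lambda>x. w x - d x)" "Y n (Suc j) = (\<lambda>x. w x + d x)"
    using fully_discrete_midpoint[OF assms(1,2) Suc_le_lessD[OF Suc.prems]] by blast
  show ?case
    using midpoint_step.rip_add[OF m(1)] midpoint_step.rip_diff[OF m(1)] Suc
    unfolding m(2,3) by simp
qed (use fully_discrete_endpoints[OF assms(1,2)] in simp)

lemma fully_discrete_mass:
  assumes "fully_discrete s N p k M U Y" "n \<le> M"
  shows "rip (U n) (U n) = rip (U 0) (U 0)"
  using assms(2)
proof (induction n)
  case (Suc n)
  thus ?case
    using fully_discrete_mass_stage[OF assms(1), of n "stages p"]
      fully_discrete_endpoints[OF assms(1), of n] by simp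
qed simp

section \<open>Uniqueness of the stages\<close>

lemma cubic_lipschitz:
  assumes "(cmod (u x))\<^sup>2 \<le> m" "(cmod (v x))\<^sup>2 \<le> m"
  shows "cmod (cubic u x - cubic v x) \<le> 3 * m * cmod (u x - v x)"
proof -
  let ?a = "u x" and ?b = "v x"
  have "cubic u x - cubic v x
      = complex_of_real ((cmod ?a)\<^sup>2) * (?a - ?b) + complex_of_real ((cmod ?a)\<^sup>2 - (cmod ?b)\<^sup>2) * ?b"
    by (simp add: cubic_def algebra_simps)
  also have "cmod \<dots> \<le> (cmod ?a)\<^sup>2 * cmod (?a - ?b) + \<bar>(cmod ?a)\<^sup>2 - (cmod ?b)\<^sup>2\<bar> * cmod ?b"
    by (rule norm_triangle_le) (simp only: norm_mult norm_of_real abs_power2 order_refl)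
  also have "\<bar>(cmod ?a)\<^sup>2 - (cmod ?b)\<^sup>2\<bar> = \<bar>cmod ?a - cmod ?b\<bar> * (cmod ?a + cmod ?b)"
    by (simp add: power2_eq_square square_diff_square_factored abs_mult)
  also have "(cmod ?a)\<^sup>2 * cmod (?a - ?b) + \<bar>cmod ?a - cmod ?b\<bar> * (cmod ?a + cmod ?b) * cmod ?b
      \<le> (cmod ?a)\<^sup>2 * cmod (?a - ?b) + cmod (?a - ?b) * (cmod ?a + cmod ?b) * cmod ?b"
    by (intro add_mono mult_right_mono norm_triangle_ineq3) auto
  also have "\<dots> = ((cmod ?a)\<^sup>2 + cmod ?a * cmod ?b + (cmod ?b)\<^sup>2) * cmod (?a - ?b)"
    by (simp add: algebra_simps power2_eq_square)
  \<comment> \<open>The mixed product is at most the mean of the two squares, hence at most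
    \<open>m\<close>.\<close>
  also have "\<dots> \<le> (3 * m) * cmod (?a - ?b)"
    using assms sum_squares_bound[of "cmod ?a" "cmod ?b"] by (intro mult_right_mono) auto
  finally show ?thesis .
qed

text \<open>With a common start value the midpoints differ by exactly as much as the half
  increments. Testing the difference of the two equations with that difference \<open>e\<close>
  removes the linear part, and the Lipschitz bound leaves \<open>rip e e\<close> at most a factor
  below 1 times itself.\<close>

lemma midpoint_unique:
  assumes "midpoint_step s N h w d" "midpoint_step s N h w' d'"
    and eq: "(\<lambda>x. w x - d x) = (\<lambda>x. w' x - d' x)"
    and r: "rip w w \<le> r" "rip w' w' \<le> r"
    and small: "3 * (2 * real N + 1) * r * \<bar>h\<bar> < 2 * pi"
  shows "w = w'"
proof -
  interpret a: midpoint_step s N h w d by fact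
  interpret b: midpoint_step s N h w' d' by fact
  define e where "e = (\<lambda>x. w x - w' x)"
  define g where "g = (\<lambda>x. cubic w x - cubic w' x)"
  \<comment> \<open>The inverse inequality bounds |w|^2 and |w'|^2 by this \<open>m\<close>, so that
    \<open>small\<close> reads \<open>3 * m * \<bar>h\<bar> < 1\<close>.\<close>
  define m where "m = (2 * real N + 1) * r / (2 * pi)"
  have e: "e \<in> trig_space N" unfolding e_def by (intro trig_space_diff a.w b.w)
  hence cont_e: "continuous_on UNIV e" by (rule continuous_on_trig_space)
  have ie: "continuous_on UNIV (\<lambda>x. \<i> * e x)" by (intro continuous_intros cont_e)
  have cubics: "continuous_on UNIV (cubic w)" "continuous_on UNIV (cubic w')"
    by (intro continuous_on_cubic a.cont_w b.cont_w)+
  have g: "continuous_on UNIV g" unfolding g_def by (intro continuous_intros cubics)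
  have e_alt: "e = (\<lambda>x. d x - d' x)"
    using eq by (auto simp: e_def fun_eq_iff algebra_simps)
  have m: "(cmod (v x))\<^sup>2 \<le> m" if "v \<in> trig_space N" "rip v v \<le> r" for v x
  proof -
    have "2 * pi * (cmod (v x))\<^sup>2 \<le> (2 * real N + 1) * r"
      by (rule order_trans[OF trig_space_sup_le_L2[OF that(1)]]) (intro mult_left_mono that, auto)
    thus ?thesis by (simp add: m_def field_simps)
  qed
  have "rip e e = rip (\<lambda>x. d x - d' x) e" using e_alt by simp
  also have "\<dots> = rip d e - rip d' e"
    by (intro rip_diff_left a.cont_d b.cont_d cont_e)
  also have "\<dots> = h * ((Dform s N w (\<lambda>x. \<i> * e x) - Dform s N w' (\<lambda>x. \<i> * e x))
      - (rip (cubic w) (\<lambda>x. \<i> * e x) - rip (cubic w') (\<lambda>x. \<i> * e x)))"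
    by (simp add: a.rip_d[OF e] b.rip_d[OF e] algebra_simps)
  also have "Dform s N w (\<lambda>x. \<i> * e x) - Dform s N w' (\<lambda>x. \<i> * e x) = Dform s N e (\<lambda>x. \<i> * e x)"
    unfolding e_def by (intro Dform_diff_left [symmetric] a.cont_w b.cont_w)
  also have "\<dots> = 0"
    using Dform_i[of s N e] by (simp add: Dform_commute)
  also have "rip (cubic w) (\<lambda>x. \<i> * e x) - rip (cubic w') (\<lambda>x. \<i> * e x) = rip g (\<lambda>x. \<i> * e x)"
    unfolding g_def by (intro rip_diff_left [symmetric] cubics ie)
  finally have ee: "rip e e = - h * rip g (\<lambda>x. \<i> * e x)" by simp
  have gi: "\<bar>g x \<bullet> (\<i> * e x)\<bar> \<le> 3 * m * (cmod (e x))\<^sup>2 + 0 * (cmod (e x))\<^sup>2" for x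
  proof -
    have "\<bar>g x \<bullet> (\<i> * e x)\<bar> \<le> cmod (g x) * cmod (\<i> * e x)"
      by (rule Cauchy_Schwarz_ineq2)
    also have "\<dots> \<le> (3 * m * cmod (e x)) * cmod (\<i> * e x)"
      unfolding g_def e_def
      by (intro mult_right_mono cubic_lipschitz m a.w b.w r) auto
    finally show ?thesis by (simp add: norm_mult power2_eq_square mult.assoc)
  qed
  have "rip g (\<lambda>x. \<i> * e x) \<le> 3 * m * rip e e + 0 * rip e e"
    using gi by (intro rip_le g ie cont_e) (simp add: abs_le_iff)
  moreover have "rip (\<lambda>x. - g x) (\<lambda>x. \<i> * e x) \<le> 3 * m * rip e e + 0 * rip e e"
    using gi by (intro rip_le continuous_on_minus g ie cont_e) (simp add: abs_le_iff)
  moreover have "rip (\<lambda>x. - g x) (\<lambda>x. \<i> * e x) = - rip g (\<lambda>x. \<i> * e x)"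
    by (simp add: rip_def)
  ultimately have "\<bar>rip g (\<lambda>x. \<i> * e x)\<bar> \<le> 3 * m * rip e e"
    by (simp add: abs_le_iff)
  hence "\<bar>h\<bar> * \<bar>rip g (\<lambda>x. \<i> * e x)\<bar> \<le> \<bar>h\<bar> * (3 * m * rip e e)"
    by (rule mult_left_mono) simp
  hence "rip e e \<le> (3 * m * \<bar>h\<bar>) * rip e e"
    using abs_ge_self[of "rip e e"] unfolding ee abs_mult by (simp add: mult_ac)
  moreover have "3 * m * \<bar>h\<bar> < 1"
    using small by (simp add: m_def field_simps)
  ultimately have "rip e e \<le> 0"
    by (metis mult_le_cancel_right1 not_le)
  hence "2 * pi * (cmod (e x))\<^sup>2 \<le> 0" for x
    by (intro order_trans[OF trig_space_sup_le_L2[OF e]] mult_nonneg_nonpos) auto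
  hence "e x = 0" for x
    using pi_gt_zero by (simp add: mult_le_0_iff)
  thus "w = w'" by (auto simp: e_def fun_eq_iff)
qed

text \<open>Mass conservation bounds every midpoint by the initial mass, so one step size condition
  on \<open>U 0\<close> serves all stages and all steps.\<close>

lemma fully_discrete_unique:
  assumes fd: "fully_discrete s N p k M U Y" "fully_discrete s N p k M U' Y'"
    and U0: "U' 0 = U 0" and "N \<ge> 1" "k > 0" and p: "p \<ge> 1"
    and small: "3 * (L2norm (U 0))\<^sup>2 * k * real N * (MAX j\<in>{1..stages p}. \<bar>bcoef p j\<bar>) < 1"
    and "n < M" "j \<le> stages p"
  shows "Y' n j = Y n j"
proof -
  let ?R = "rip (U 0) (U 0)" and ?b = "MAX j\<in>{1..stages p}. \<bar>bcoef p j\<bar>"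
  have "U 0 \<in> trig_space N" using fd(1) by (simp add: fully_discrete_def)
  hence cont: "continuous_on UNIV (U 0)" by (rule continuous_on_trig_space)
  hence R: "(L2norm (U 0))\<^sup>2 = ?R" "?R \<ge> 0"
    by (auto simp: L2norm_power2 rip_self_nonneg)
  have stage: "Y' n j = Y n j" if n: "n < M" and UU: "U' n = U n" and j: "j \<le> stages p" for n j
    using j
  proof (induction j)
    case (Suc j)
    hence j: "j < stages p" and IH: "Y' n j = Y n j" by auto
    let ?h = "k * bcoef p (Suc j) / 2"
    obtain w d where m: "midpoint_step s N ?h w d"
      "Y n j = (\<lambda>x. w x - d x)" "Y n (Suc j) = (\<lambda>x. w x + d x)"
      using fully_discrete_midpoint[OF fd(1) n j] by blast
    obtain w' d' where m': "midpoint_step s N ?h w' d'"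
      "Y' n j = (\<lambda>x. w' x - d' x)" "Y' n (Suc j) = (\<lambda>x. w' x + d' x)"
      using fully_discrete_midpoint[OF fd(2) n j] by blast
    have le: "rip v v \<le> ?R" if mid: "midpoint_step s N ?h v c" and y: "y = (\<lambda>x. v x - c x)"
      and r: "rip y y = ?R" for v c y
    proof -
      interpret midpoint_step s N ?h v c by fact
      show ?thesis using rip_diff rip_self_nonneg[OF cont_d] r by (simp add: y)
    qed
    have "rip (Y n j) (Y n j) = ?R"
      using fully_discrete_mass_stage[OF fd(1) n] fully_discrete_mass[OF fd(1), of n] n j by simp
    hence r: "rip w w \<le> ?R" "rip w' w' \<le> ?R"
      using le[OF m(1,2)] le[OF m'(1,2)] IH by auto
    \<comment> \<open>Here \<open>N \<ge> 1\<close> enters. With the half substep the quantity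
      required by \<open>midpoint_unique\<close> is below 3/2, hence below 2 pi.\<close>
    have "2 * real N + 1 \<le> 3 * real N" using \<open>N \<ge> 1\<close> by simp
    moreover have "\<bar>bcoef p (Suc j)\<bar> \<le> ?b"
      using j by (intro Max_ge) auto
    ultimately have "3 * (2 * real N + 1) * ?R * \<bar>?h\<bar> \<le> 3 * (3 * real N) * ?R * (k * ?b / 2)"
      using R \<open>k > 0\<close> by (intro mult_mono) (auto simp: abs_mult intro: mult_nonneg_nonneg)
    also have "\<dots> = 3 / 2 * (3 * ?R * k * real N * ?b)" by simp
    also have "\<dots> < 3 / 2 * 1"
      using small R by (intro mult_strict_left_mono) auto
    also have "\<dots> < 2 * pi" using pi_gt3 by simp
    finally have ww: "w = w'"
      using midpoint_unique[OF m(1) m'(1) _ r] m(2) m'(2) IH by simp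
    have "d = d'"
      using m(1) m'(1) unfolding midpoint_step_def ww by simp
    thus ?case by (simp add: m(3) m'(3) ww)
  qed (use fully_discrete_endpoints[OF fd(1) n] fully_discrete_endpoints[OF fd(2) n] UU in simp)
  have "U' n = U n" if "n \<le> M" for n
    using that
  proof (induction n)
    case (Suc n)
    thus ?case
      using stage[of n "stages p"] fully_discrete_endpoints[OF fd(1), of n]
        fully_discrete_endpoints[OF fd(2), of n] by simp
  qed (rule U0)
  thus ?thesis using stage assms by simp
qed

text \<open>A bootstrap: while the energy is at most \<open>H0 + 1\<close>, coercivity supplies the
  bound \<open>B\<close> that \<open>step\<close> needs, and each stage adds at most
  \<open>\<eta> * \<bar>h\<bar>\<close>. Half of the absolute coefficients sum to
  \<open>\<beta>\<close>, so the total drift never exceeds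
  \<open>\<eta> * (real M * k * \<beta>) \<le> 1\<close>.\<close>

lemma fully_discrete_energy:
  fixes p :: nat
  defines "\<beta> \<equiv> (\<Sum>j\<in>{1..stages p}. \<bar>bcoef p j\<bar>) / 2"
  assumes fd: "fully_discrete s N p k M U Y" and k: "k > 0" "k * \<beta> \<le> \<delta>"
    and \<eta>: "\<eta> > 0" "\<eta> * (real M * k * \<beta>) \<le> 1"
    and mass: "rip (U 0) (U 0) \<le> K"
    and coercive: "\<And>u. u \<in> trig_space N \<Longrightarrow> rip u u \<le> K \<Longrightarrow> Ham s u \<le> H0 + 1 \<Longrightarrow> Dform s N u u \<le> B"
    and step: "\<And>h w d. midpoint_step s N h w d \<Longrightarrow> \<bar>h\<bar> \<le> \<delta> \<Longrightarrow> rip w w + rip d d \<le> K \<Longrightarrow>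
      Dform s N (\<lambda>x. w x - d x) (\<lambda>x. w x - d x) \<le> B \<Longrightarrow>
      Ham s (\<lambda>x. w x + d x) \<le> Ham s (\<lambda>x. w x - d x) + \<eta> * \<bar>h\<bar>"
    and H0: "Ham s (U 0) \<le> H0" and "n \<le> M"
  shows "Ham s (U n) \<le> H0 + 1"
proof -
  \<comment> \<open>The share of \<open>\<beta>\<close> already spent after \<open>j\<close> stages
    of the current step.\<close>
  define \<sigma> where "\<sigma> j = (\<Sum>i\<in>{1..j}. \<bar>bcoef p i\<bar>) / 2" for j
  have \<sigma>_Suc: "\<sigma> (Suc j) = \<sigma> j + \<bar>bcoef p (Suc j)\<bar> / 2" for j
    by (simp add: \<sigma>_def add_divide_distrib)
  have \<sigma>: "\<sigma> j \<le> \<beta>" if "j \<le> stages p" for j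
    unfolding \<sigma>_def \<beta>_def using that by (intro divide_right_mono sum_mono2) auto
  have \<sigma>_nonneg: "\<sigma> j \<ge> 0" for j by (simp add: \<sigma>_def sum_nonneg)
  have \<beta>: "\<beta> \<ge> 0" by (simp add: \<beta>_def sum_nonneg)
  have small: "\<eta> * (k * (real n * \<beta> + \<sigma> j)) \<le> 1" if "n < M" "j \<le> stages p" for n j
  proof -
    have "real n * \<beta> + \<sigma> j \<le> real n * \<beta> + 1 * \<beta>"
      using \<sigma>[OF that(2)] by simp
    also have "\<dots> = real (Suc n) * \<beta>" by (simp add: algebra_simps)
    also have "\<dots> \<le> real M * \<beta>"
      using that \<beta> by (intro mult_right_mono) auto
    finally have "\<eta> * (k * (real n * \<beta> + \<sigma> j)) \<le> \<eta> * (k * (real M * \<beta>))"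
      using k \<eta> by (intro mult_left_mono) auto
    also have "\<dots> = \<eta> * (real M * k * \<beta>)" by simp
    also note \<eta>(2)
    finally show ?thesis .
  qed
  have stage: "Ham s (Y n j) \<le> H0 + \<eta> * (k * (real n * \<beta> + \<sigma> j))"
    if n: "n < M" and IHn: "Ham s (U n) \<le> H0 + \<eta> * (k * (real n * \<beta>))" and "j \<le> stages p" for n j
    using that(3)
  proof (induction j)
    case 0
    thus ?case using IHn fully_discrete_endpoints[OF fd n] by (simp add: \<sigma>_def)
  next
    case (Suc j)
    hence j: "j < stages p" by simp
    let ?h = "k * bcoef p (Suc j) / 2"
    obtain w d where m: "midpoint_step s N ?h w d"
      "Y n j = (\<lambda>x. w x - d x)" "Y n (Suc j) = (\<lambda>x. w x + d x)"
      using fully_discrete_midpoint[OF fd n j] by blast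
    have H: "Ham s (Y n j) \<le> H0 + \<eta> * (k * (real n * \<beta> + \<sigma> j))"
      using Suc by simp
    have mass_j: "rip (Y n j) (Y n j) \<le> K"
      using fully_discrete_mass_stage[OF fd n] fully_discrete_mass[OF fd, of n] n j mass by simp
    have "\<bar>bcoef p (Suc j)\<bar> / 2 \<le> \<beta>"
      using \<sigma>[OF Suc.prems] \<sigma>_nonneg[of j] by (simp add: \<sigma>_Suc)
    hence "k * (\<bar>bcoef p (Suc j)\<bar> / 2) \<le> k * \<beta>"
      using k by (intro mult_left_mono) auto
    also note k(2)
    also have "k * (\<bar>bcoef p (Suc j)\<bar> / 2) = \<bar>?h\<bar>"
      using k(1) by (simp add: abs_mult)
    finally have h: "\<bar>?h\<bar> \<le> \<delta>" .
    have "Dform s N (Y n j) (Y n j) \<le> B"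
      using coercive[OF fully_discrete_stage(2)[OF fd n j] mass_j] H small[OF n, of j] j by simp
    moreover have "rip w w + rip d d \<le> K"
      using mass_j midpoint_step.rip_diff[OF m(1)] by (simp add: m(2))
    ultimately have "Ham s (Y n (Suc j)) \<le> Ham s (Y n j) + \<eta> * \<bar>?h\<bar>"
      using step[OF m(1) h] by (simp add: m(2,3))
    also have "\<eta> * \<bar>?h\<bar> = \<eta> * (k * (\<bar>bcoef p (Suc j)\<bar> / 2))"
      using k by (simp add: abs_mult)
    finally show ?case using H by (simp add: \<sigma>_Suc algebra_simps)
  qed
  have bound: "Ham s (U n) \<le> H0 + \<eta> * (k * (real n * \<beta>))" if "n \<le> M" for n
    using that
  proof (induction n)
    case (Suc n)
    hence n: "n < M" by simp
    have "Ham s (Y n (stages p)) \<le> H0 + \<eta> * (k * (real n * \<beta> + \<sigma> (stages p)))"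
      using Suc n by (intro stage) auto
    moreover have "\<sigma> (stages p) = \<beta>" by (simp add: \<sigma>_def \<beta>_def)
    ultimately show ?case
      using fully_discrete_endpoints[OF fd n] by (simp add: algebra_simps)
  qed (use H0 in simp)
  have "real n * \<beta> \<le> real M * \<beta>"
    using \<open>n \<le> M\<close> \<beta> by (intro mult_right_mono) auto
  hence "\<eta> * (k * (real n * \<beta>)) \<le> \<eta> * (k * (real M * \<beta>))"
    using k \<eta> by (intro mult_left_mono) auto
  thus ?thesis using bound[OF \<open>n \<le> M\<close>] \<eta> by (simp add: mult_ac)
qed

section \<open>The Sobolev bound\<close>

lemma rip_proj_le:
  assumes "continuous_on UNIV f"
  shows "rip (proj N f) (proj N f) \<le> rip f f"
proof -
  have c: "continuous_on UNIV (proj N f)" by (rule continuous_on_trig_space) auto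
  have "rip (proj N f) (proj N f) = rip f (proj N f)"
    by (rule rip_proj[OF assms]) auto
  \<comment> \<open>The second half is absorbed on the left, which yields Bessel's
    inequality.\<close>
  also have "\<dots> \<le> 1/2 * rip f f + 1/2 * rip (proj N f) (proj N f)"
    by (rule rip_le) (use inner_young[of "1/2"] assms c in \<open>auto simp: power2_norm_eq_inner\<close>)
  finally show ?thesis by simp
qed

text \<open>Integration by parts, as the fundamental theorem for the product with the exponential;
  the boundary terms agree by periodicity.\<close>

lemma fourier_coeff_deriv:
  assumes per: "periodic2pi u"
    and der: "\<And>x. (u has_vector_derivative u' x) (at x)"
    and cont: "continuous_on UNIV u'"
  shows "fourier_coeff u' k = \<i> * of_int k * fourier_coeff u k"
proof -
  let ?e = "\<lambda>x. exp (- \<i> * of_int k * complex_of_real x)"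
  have cu: "continuous_on UNIV u"
    using der has_vector_derivative_continuous continuous_at_imp_continuous_on by blast
  have "((\<lambda>x. u' x * ?e x - \<i> * of_int k * (u x * ?e x)) has_integral u pi * ?e pi - u (-pi) * ?e (-pi)) {-pi..pi}"
  proof (rule fundamental_theorem_of_calculus)
    fix x
    have "(?e has_vector_derivative - \<i> * of_int k * ?e x) (at x within {-pi..pi})"
      by (auto intro!: derivative_eq_intros has_vector_derivative_real_field)
    from has_vector_derivative_mult[OF has_vector_derivative_at_within[OF der] this]
    show "((\<lambda>x. u x * ?e x) has_vector_derivative u' x * ?e x - \<i> * of_int k * (u x * ?e x)) (at x within {-pi..pi})"
      by (simp add: algebra_simps)
  qed simp
  moreover have "u pi = u (-pi)"
    using per[unfolded periodic2pi_def, rule_format, of "-pi"] by simp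
  moreover have "?e pi = ?e (-pi)"
    unfolding exp_eq by (rule exI[of _ "-k"]) (simp add: algebra_simps)
  ultimately have "integral {-pi..pi} (\<lambda>x. u' x * ?e x - \<i> * of_int k * (u x * ?e x)) = 0"
    by (simp add: integral_unique)
  also have "integral {-pi..pi} (\<lambda>x. u' x * ?e x - \<i> * of_int k * (u x * ?e x))
      = integral {-pi..pi} (\<lambda>x. u' x * ?e x) - \<i> * of_int k * integral {-pi..pi} (\<lambda>x. u x * ?e x)"
    by (subst integral_diff) (auto intro!: integrable_period continuous_intros cu cont)
  finally show ?thesis by (simp add: fourier_coeff_def mult_ac)
qed

text \<open>For s <= 1 and integer k the weight |k|^(2s) is at most k^2, and Bessel's inequality for
  the derivative gives a bound without \<open>N\<close>.\<close>

lemma Dform_proj_le: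
  assumes "s \<le> 1" "periodic2pi u"
    and "\<And>x. (u has_vector_derivative u' x) (at x)" "continuous_on UNIV u'"
  shows "Dform s N (proj N u) (proj N u) \<le> rip u' u'"
proof -
  have "\<bar>real_of_int k\<bar> powr (2 * s) \<le> (real_of_int k)\<^sup>2" for k
  proof (cases "k = 0")
    case False
    hence "\<bar>real_of_int k\<bar> powr (2 * s) \<le> \<bar>real_of_int k\<bar> powr 2"
      using assms(1) by (intro powr_mono) auto
    thus ?thesis using False by simp
  qed simp
  hence "Dform s N (proj N u) (proj N u)
      \<le> 2 * pi * (\<Sum>k\<in>{- int N..int N}. (real_of_int k)\<^sup>2 * (cmod (fourier_coeff u k))\<^sup>2)"
    unfolding Dform_def proj_eq_trig
    by (intro mult_left_mono sum_mono) (auto simp: fourier_coeff_trig power2_norm_eq_inner intro: mult_right_mono)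
  also have "\<dots> = rip (proj N u') (proj N u')"
    using fourier_coeff_deriv[OF assms(2-4)]
    by (subst rip_self_trig_space[of _ N])
      (auto simp: proj_eq_trig fourier_coeff_trig norm_mult power_mult_distrib intro!: sum.cong)
  also have "\<dots> \<le> rip u' u'"
    by (rule rip_proj_le) fact
  finally show ?thesis .
qed

lemma sobolev_norm_le:
  assumes "u \<in> trig_space N" "0 < s" "s \<le> 1"
  shows "sobolev_norm s u \<le> sqrt (rip u u + Dform s N u u)"
proof -
  have w: "(1 + (real_of_int k)\<^sup>2) powr s \<le> 2 * (1 + \<bar>real_of_int k\<bar> powr (2 * s))" for k
  proof (cases "k = 0")
    \<comment> \<open>A nonzero integer has k^2 >= 1, so 1 + k^2 <= 2 k^2, and 2^s <= 2 since s <=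
      1.\<close>
    case False
    hence "(real_of_int k)\<^sup>2 \<ge> 1"
      by (metis of_int_1_le_iff of_int_power zero_less_power2 int_one_le_iff_zero_less)
    hence "(1 + (real_of_int k)\<^sup>2) powr s \<le> (2 * (real_of_int k)\<^sup>2) powr s"
      using assms by (intro powr_mono2) auto
    also have "\<dots> = 2 powr s * \<bar>real_of_int k\<bar> powr (2 * s)"
    proof -
      have "(real_of_int k)\<^sup>2 powr s = (\<bar>real_of_int k\<bar> powr 2) powr s"
        using False by simp
      thus ?thesis by (simp only: powr_mult powr_powr)
    qed
    also have "\<dots> \<le> 2 powr 1 * \<bar>real_of_int k\<bar> powr (2 * s)"
      using assms by (intro mult_right_mono powr_mono) auto
    finally show ?thesis by simp
  qed simp
  have z: "fourier_coeff u k = 0" if "k \<notin> {- int N..int N}" for k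
    using assms(1) that by (auto simp: trig_space_iff fourier_coeff_trig)
  have "(\<Sum>\<^sub>\<infinity>k\<in>(UNIV::int set). (1 + (real_of_int k)\<^sup>2) powr s * (cmod (fourier_coeff u k))\<^sup>2)
      = (\<Sum>\<^sub>\<infinity>k\<in>{- int N..int N}. (1 + (real_of_int k)\<^sup>2) powr s * (cmod (fourier_coeff u k))\<^sup>2)"
    by (rule infsum_cong_neutral) (auto simp: z)
  also have "\<dots> = (\<Sum>k\<in>{- int N..int N}. (1 + (real_of_int k)\<^sup>2) powr s * (cmod (fourier_coeff u k))\<^sup>2)"
    by simp
  also have "\<dots> \<le> (\<Sum>k\<in>{- int N..int N}. 2 * (1 + \<bar>real_of_int k\<bar> powr (2 * s)) * (cmod (fourier_coeff u k))\<^sup>2)"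
    by (intro sum_mono mult_right_mono w) auto
  also have "\<dots> = 2 * (\<Sum>k\<in>{- int N..int N}. (1 + \<bar>real_of_int k\<bar> powr (2 * s)) * (cmod (fourier_coeff u k))\<^sup>2)"
    by (simp only: sum_distrib_left mult.assoc)
  \<comment> \<open>The comparison factor 2 disappears into the Parseval factor.\<close>
  also have "\<dots> \<le> (2 * pi) * (\<Sum>k\<in>{- int N..int N}. (1 + \<bar>real_of_int k\<bar> powr (2 * s)) * (cmod (fourier_coeff u k))\<^sup>2)"
    using pi_ge_two by (intro mult_right_mono sum_nonneg) auto
  also have "\<dots> = rip u u + Dform s N u u"
    by (simp add: rip_self_trig_space[OF assms(1)] Dform_def power2_norm_eq_inner distrib_right sum.distrib distrib_left)
  finally show ?thesis by (simp add: sobolev_norm_def)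
qed

text \<open>All constants are fixed from \<open>T\<close>, \<open>s\<close>, \<open>u0\<close> and
  \<open>p\<close> before \<open>N\<close> and \<open>k\<close> appear; this order is what makes the
  bound uniform.\<close>

lemma fully_discrete_sobolev_bound:
  fixes T s :: real and u0 :: "real \<Rightarrow> complex" and p :: nat
  assumes T: "T > 0" and u0: "smooth u0" "periodic2pi u0"
    and s: "1/2 < s" "s \<le> 1"
  obtains k0 C where "k0 > 0"
    and "\<And>N k M U Y n. 0 < k \<Longrightarrow> k < k0 \<Longrightarrow> T = real M * k \<Longrightarrow> fully_discrete s N p k M U Y \<Longrightarrow>
      U 0 = proj N u0 \<Longrightarrow> n \<le> M \<Longrightarrow> sobolev_norm s (U n) \<le> C"
proof -
  define u1 where "u1 = (\<lambda>x. vector_derivative u0 (at x))"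
  \<comment> \<open>Orders 0 and 1 of smoothness make \<open>u1\<close> continuous, being
    differentiable itself.\<close>
  have diff: "u0 differentiable (at x)" "u1 differentiable (at x)" for x
    using u0(1)[unfolded smooth_def, rule_format, of 0 x] u0(1)[unfolded smooth_def, rule_format, of 1 x]
    by (simp_all add: u1_def)
  have der: "(u0 has_vector_derivative u1 x) (at x)" for x
    using diff(1) by (simp add: u1_def vector_derivative_works)
  have cont: "continuous_on UNIV u0" "continuous_on UNIV u1"
    by (intro continuous_at_imp_continuous_on ballI differentiable_imp_continuous_within diff)+
  define K where "K = rip u0 u0"
  define H0 where "H0 = rip u1 u1 / 2"
  have K: "K \<ge> 0" and H0: "H0 \<ge> 0" using cont by (auto simp: K_def H0_def rip_self_nonneg)
  define \<beta> where "\<beta> = (\<Sum>j\<in>{1..stages p}. \<bar>bcoef p j\<bar>) / 2"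
  \<comment> \<open>Keeps the accumulated drift \<open>\<eta> * (T * \<beta>)\<close> at most
    1.\<close>
  define \<eta> where "\<eta> = 1 / (T * \<beta> + 1)"
  have \<beta>: "\<beta> \<ge> 0" by (simp add: \<beta>_def sum_nonneg)
  have T\<beta>: "T * \<beta> + 1 > 0" using T \<beta> by (intro add_nonneg_pos mult_nonneg_nonneg) auto
  hence \<eta>: "\<eta> > 0" "\<eta> * (T * \<beta>) \<le> 1" by (auto simp: \<eta>_def field_simps)
  obtain C where C: "C \<ge> 0"
    "\<And>N u. u \<in> trig_space N \<Longrightarrow> rip u u \<le> K \<Longrightarrow> Dform s N u u \<le> 4 * Ham s u + C"
    by (rule Ham_coercive[OF s(1) K]) blast
  define B where "B = 4 * (H0 + 1) + C"
  have B: "B \<ge> 0" using H0 C by (simp add: B_def)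
  have coercive: "Dform s N u u \<le> B" if "u \<in> trig_space N" "rip u u \<le> K" "Ham s u \<le> H0 + 1" for N u
    using C(2)[OF that(1,2)] that(3) by (simp add: B_def)
  obtain \<delta> where \<delta>: "\<delta> > 0"
    "\<And>N h w d. midpoint_step s N h w d \<Longrightarrow> \<bar>h\<bar> \<le> \<delta> \<Longrightarrow> rip w w + rip d d \<le> K \<Longrightarrow>
      Dform s N (\<lambda>x. w x - d x) (\<lambda>x. w x - d x) \<le> B \<Longrightarrow>
      Ham s (\<lambda>x. w x + d x) \<le> Ham s (\<lambda>x. w x - d x) + \<eta> * \<bar>h\<bar>"
    by (rule energy_step[OF s(1) K B \<eta>(1)]) blast
  show thesis
  \<comment> \<open>The first witness forces \<open>k * \<beta> \<le> \<delta>\<close>, so every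
    half substep is admissible for the energy estimate; the second adds the mass and the form
    bounds.\<close>
  proof (rule that[of "\<delta> / (\<beta> + 1)" "sqrt (K + B)"])
    show "\<delta> / (\<beta> + 1) > 0" using \<delta> \<beta> by simp
    fix N k M U Y n
    assume k: "0 < k" "k < \<delta> / (\<beta> + 1)" and Tk: "T = real M * k"
      and fd: "fully_discrete s N p k M U Y" and U0: "U 0 = proj N u0" and n: "n \<le> M"
    have "k * \<beta> \<le> k * (\<beta> + 1)" using k by simp
    also have "\<dots> < \<delta>" using k(2) \<beta> by (simp add: field_simps)
    finally have k\<delta>: "k * \<beta> \<le> \<delta>" by simp
    have mass: "rip (U 0) (U 0) \<le> K"
      unfolding U0 K_def by (rule rip_proj_le[OF cont(1)])
    have "Ham s (U 0) \<le> Dform s N (proj N u0) (proj N u0) / 2"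
      unfolding U0 by (rule Ham_le_Dform) auto
    also have "\<dots> \<le> H0"
      using Dform_proj_le[OF s(2) u0(2) der cont(2), of N] by (simp add: H0_def)
    finally have H: "Ham s (U 0) \<le> H0" .
    have "\<eta> * (real M * k * \<beta>) \<le> 1"
      using \<eta>(2) by (simp add: Tk)
    hence "Ham s (U n) \<le> H0 + 1"
      unfolding \<beta>_def
      by (rule fully_discrete_energy[OF fd k(1) k\<delta>[unfolded \<beta>_def] \<eta>(1) _ mass coercive \<delta>(2) H n])
    moreover have un: "U n \<in> trig_space N" using fd n by (simp add: fully_discrete_def)
    moreover have "rip (U n) (U n) \<le> K"
      using fully_discrete_mass[OF fd n] mass by simp
    ultimately have "rip (U n) (U n) + Dform s N (U n) (U n) \<le> K + B"
      using coercive by (intro add_mono) auto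
    thus "sobolev_norm s (U n) \<le> sqrt (K + B)"
      using sobolev_norm_le[OF un] s by (meson less_trans order_trans real_sqrt_le_mono half_gt_zero zero_less_one)
  qed
qed

theorem lemma3p2:
  fixes T s :: real and u0 :: "real \<Rightarrow> complex" and p :: nat
  assumes "T > 0"
    and "smooth u0" and "periodic2pi u0"
    and "p \<ge> 1"
    and "0 < s" and "s \<le> 1"
  shows
    "(\<forall>(N::nat) (k::real) (M::nat) U Y U' Y'.
        N \<ge> 1 \<longrightarrow> k > 0 \<longrightarrow> T = real M * k \<longrightarrow>
        fully_discrete s N p k M U Y \<longrightarrow>
        fully_discrete s N p k M U' Y' \<longrightarrow>
        U' 0 = U 0 \<longrightarrow>
        3 * (L2norm (U 0))\<^sup>2 * k * real N * (MAX j\<in>{1..stages p}. \<bar>bcoef p j\<bar>) < 1 \<longrightarrow>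
        (\<forall>n<M. \<forall>j\<le>stages p. Y' n j = Y n j))
     \<and>
     (s > 1 / 2 \<longrightarrow>
       (\<exists>k0>0. \<exists>C_U::real. \<forall>N::nat.
          N \<ge> 1 \<longrightarrow>
          1 - (C_infty s)\<^sup>2 * I1 (proj N u0) > 0 \<longrightarrow>
          I1 (proj N u0) / 2 + Ham s (proj N u0) \<ge> 0 \<longrightarrow>
          (\<forall>(k::real) (M::nat) U Y.
             0 < k \<longrightarrow> k < k0 \<longrightarrow> T = real M * k \<longrightarrow>
             fully_discrete s N p k M U Y \<longrightarrow>
             U 0 = proj N u0 \<longrightarrow>
             (MAX n\<in>{0..M}. sobolev_norm s (U n)) \<le> C_U)))"
proof (intro conjI impI)
  assume "s > 1 / 2"
  then obtain k0 C where "k0 > 0"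
    and bound: "\<And>N k M U Y n. 0 < k \<Longrightarrow> k < k0 \<Longrightarrow> T = real M * k \<Longrightarrow> fully_discrete s N p k M U Y \<Longrightarrow>
      U 0 = proj N u0 \<Longrightarrow> n \<le> M \<Longrightarrow> sobolev_norm s (U n) \<le> C"
    by (rule fully_discrete_sobolev_bound[OF assms(1-3) _ assms(6)]) blast
  show "\<exists>k0>0. \<exists>C_U::real. \<forall>N::nat.
          N \<ge> 1 \<longrightarrow>
          1 - (C_infty s)\<^sup>2 * I1 (proj N u0) > 0 \<longrightarrow>
          I1 (proj N u0) / 2 + Ham s (proj N u0) \<ge> 0 \<longrightarrow>
          (\<forall>(k::real) (M::nat) U Y.
             0 < k \<longrightarrow> k < k0 \<longrightarrow> T = real M * k \<longrightarrow>
             fully_discrete s N p k M U Y \<longrightarrow>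
             U 0 = proj N u0 \<longrightarrow>
             (MAX n\<in>{0..M}. sobolev_norm s (U n)) \<le> C_U)"
    by (intro exI[of _ k0] exI[of _ C] conjI allI impI \<open>k0 > 0\<close> Max.boundedI) (auto intro: bound)
qed (use assms(4) fully_discrete_unique in blast)

end
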